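(* Let $K$ be an arbitrary field, $m\geq 4$, $\Gamma\in\mathbb{S}(m)$. Suppose that $s=|\operatorname{ind}(\Gamma)|\geq 2$ and $\operatorname{dec}(\Gamma)_{\geq 2}\neq\emptyset$, and let $\operatorname{ind}(\Gamma)=\{\nu_1,\ldots,\nu_s\}$. The set $\mathcal{A}(m,\Gamma)$ is an affine algebraic variety, and the algebra of regular functions on it, $\mathcal{O}(\mathcal{A}(m,\Gamma))$, is the factor algebra of the polynomial algebra $$P(m,\Gamma)=K[\lambda_{\nu_i,j}\mid i=1,\ldots,s;\ j\in C\Gamma(\nu_i)]$$ in $n(m,\Gamma)=\sum_{i=1}^s|C\Gamma(\nu_i)|$ variables $\lambda_{\nu_i,j}$ by the defining relations: for each $\gamma\in\operatorname{dec}(\Gamma)_{\geq 2}$ and $b\in\operatorname{Rel}(\gamma)\setminus\{a(\gamma)\}$, $$c_j(f^b)=c_j(f^{a(\gamma)})+\sum_{\gamma'\in\Gamma(\gamma)}\theta_{\gamma,\gamma';b}\,c_j(f^{a(\gamma')}),\quad j\in C\Gamma(\gamma).$$ The number of equations is $$l(m,\Gamma):=\sum_{\gamma\in\operatorname{dec}(\Gamma)_{\geq 2}}\big(|\operatorname{Rel}(\gamma)|-1\big)\cdot|C\Gamma(\gamma)|.$$ In particular, the dimension of the variety $\mathcal{A}(m,\Gamma)$ is not smaller than $n(m,\Gamma)-l(m,\Gamma)$.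
   Context: $\mathbb{S}(m)$ is the set consisting of the empty set and of all non-empty subsets $\Gamma\subseteq\{2,\ldots,m-2\}$ such that $\Gamma+\Gamma\subseteq\Gamma\cup[m,\infty)$. An element of $\Gamma$ is decomposable if it is a sum of two elements of $\Gamma$; $\operatorname{ind}(\Gamma)$ and $\operatorname{dec}(\Gamma)$ are the sets of indecomposable and decomposable elements. Write $\operatorname{ind}(\Gamma)=\{\nu_1<\cdots<\nu_s\}$, $\nu=(\nu_1,\ldots,\nu_s)$, $a\nu:=\sum_ia_i\nu_i$ for $a\in\mathbb{N}^s$ ($0\in\mathbb N$). For $\gamma\in\operatorname{dec}(\Gamma)$, $\operatorname{Rel}(\gamma):=\{a\in\mathbb{N}^s\mid a\nu=\gamma\}$; $\operatorname{dec}(\Gamma)_{\geq 2}:=\{\gamma\in\operatorname{dec}(\Gamma)\mid|\operatorname{Rel}(\gamma)|\geq 2\}$. For each $\gamma\in\operatorname{dec}(\Gamma)$ an element $a(\gamma)\in\operatorname{Rel}(\gamma)$ is fixed (arbitrarily), and $a(\nu_i):=e_i$, the $i$-th standard basis vector. $\Gamma(k):=\{\gamma\in\Gamma\mid\gamma>k\}$, $\Gamma(k,l):=\{\gamma\in\Gamma\mid k<\gamma<l\}$, $C\Gamma(k):=\{\delta\mid\delta\notin\Gamma,k<\delta\leq m-1\}$. $\mathcal{A}(m)$ is the set of all $K$-subalgebras $A$ of $K[x]$ such that $x^mK[x]\subset A$ and $x^{m-1}\notin A$. For $A\in\mathcal{A}(m)$, $\Gamma_A\in\mathbb{S}(m)$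 is the set of integers $\gamma$ with $1\leq\gamma\leq m-1$ such that $A$ contains an element of the form $x^\gamma+\sum_{j>\gamma}\lambda_jx^j$. $\mathcal{A}(m,\Gamma):=\{A\in\mathcal{A}(m)\mid\Gamma_A=\Gamma\}$. For $A\in\mathcal{A}(m,\Gamma)$, $\overline{A}:=A/x^mK[x]\subseteq K[x]/x^mK[x]$ has a unique $K$-basis $\{1,f_\gamma\mid\gamma\in\Gamma\}$ (the canonical basis) with $f_\gamma=x^\gamma+\sum_{\delta\in C\Gamma(\gamma)}\lambda_{\gamma,\delta}x^\delta$. The coefficients $\lambda_{\nu_i,j}$ ($i=1,\ldots,s$, $j\in C\Gamma(\nu_i)$) of $f_{\nu_1},\ldots,f_{\nu_s}$ uniquely determine $A$ and are treated as regular functions (coordinates) on $\mathcal{A}(m,\Gamma)$, which is thus viewed as a subset of affine space of dimension $n(m,\Gamma)$. In the relations, $\lambda_{\nu_i,j}$ are indeterminates, $f_{\nu_i}=x^{\nu_i}+\sum_{j\in C\Gamma(\nu_i)}\lambda_{\nu_i,j}x^j\in P(m,\Gamma)[x]$, $f^a:=\prod_{i=1}^sf_{\nu_i}^{a_i}$ for $a\in\mathbb{N}^s$, and $c_j(f)$ is the coefficient of $x^j$ in $f$. For $\gamma\in\operatorname{dec}(\Gamma)_{\geq 2}$ and $b\in\operatorname{Rel}(\gamma)\setminus\{a(\gamma)\}$, the polynomials $\theta_{\gamma,\gamma';b}\in P(m,\Gamma)$, $\gamma'\in\Gamma(\gamma)$, are the unique solution of the unitriangular linear system $$\theta_{\gamma,\gamma';b}+\sum_{\gamma''\in\Gamma(\gamma,\gamma')}\theta_{\gamma,\gamma'';b}\,c_{\gamma'}\big(f^{a(\gamma'')}\big)=c_{\gamma'}\big(f^b-f^{a(\gamma)}\big),\quad\gamma'\in\Gamma(\gamma).$$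 *)

theory Defs
  imports
    "HOL-Algebra.Algebraic_Closure_Type"
    "HOL-Algebra.Subrings"
    "HOL-Library.Poly_Mapping"
    "HOL-Analysis.Extended_Real_Limits"
begin

section \<open>Combinatorics of the sets \<open>\<Gamma>\<close>\<close>

definition semi_sets :: "nat \<Rightarrow> nat set set"  (* \<S>(m) *)
  where "semi_sets m =
    {\<Gamma>. \<Gamma> \<subseteq> {2..m - 2} \<and> (\<forall>x\<in>\<Gamma>. \<forall>y\<in>\<Gamma>. x + y \<in> \<Gamma> \<or> m \<le> x + y)}"

definition dec :: "nat set \<Rightarrow> nat set"
  where "dec \<Gamma> = {\<gamma>\<in>\<Gamma>. \<exists>x\<in>\<Gamma>. \<exists>y\<in>\<Gamma>. \<gamma> = x + y}"

definition ind :: "nat set \<Rightarrow> nat set"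
  where "ind \<Gamma> = \<Gamma> - dec \<Gamma>"

text \<open>
  The vectors \<open>a = (a\<^sub>1, \<dots>, a\<^sub>s)\<close> of natural numbers are indexed by the elements
  \<open>\<nu>\<^sub>i\<close> of \<open>ind \<Gamma>\<close> themselves instead of their positions \<open>i\<close>: such a vector is a function
  on \<open>nat\<close> that vanishes outside \<open>ind \<Gamma>\<close>, and \<open>a\<^sub>i\<close> is \<open>a \<nu>\<^sub>i\<close>.
\<close>

definition Rel :: "nat set \<Rightarrow> nat \<Rightarrow> (nat \<Rightarrow> nat) set"
  where "Rel \<Gamma> \<gamma> = {a. (\<forall>i. i \<notin> ind \<Gamma> \<longrightarrow> a i = 0) \<and> (\<Sum>\<nu>\<in>ind \<Gamma>. a \<nu> * \<nu>) = \<gamma>}"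

definition unit_vec :: "nat \<Rightarrow> nat \<Rightarrow> nat"
  where "unit_vec \<nu> = (\<lambda>i. if i = \<nu> then 1 else 0)"

definition dec2 :: "nat set \<Rightarrow> nat set"
  where "dec2 \<Gamma> = {\<gamma>\<in>dec \<Gamma>. 2 \<le> card (Rel \<Gamma> \<gamma>)}"

definition above :: "nat set \<Rightarrow> nat \<Rightarrow> nat set"  (* \<Gamma>(k) *)
  where "above \<Gamma> k = {\<gamma>\<in>\<Gamma>. k < \<gamma>}"

definition between :: "nat set \<Rightarrow> nat \<Rightarrow> nat \<Rightarrow> nat set"  (* \<Gamma>(k,l) *)
  where "between \<Gamma> k l = {\<gamma>\<in>\<Gamma>. k < \<gamma> \<and> \<gamma> < l}"

definition gaps :: "nat \<Rightarrow> nat set \<Rightarrow> nat \<Rightarrow> nat set"  (* C\<Gamma>(k) *)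
  where "gaps m \<Gamma> k = {\<delta>. \<delta> \<notin> \<Gamma> \<and> k < \<delta> \<and> \<delta> \<le> m - 1}"

text \<open>The pair \<open>(\<nu>, j)\<close> stands for the variable \<open>\<lambda>\<^bsub>\<nu>,j\<^esub>\<close>.\<close>

definition vars :: "nat \<Rightarrow> nat set \<Rightarrow> (nat \<times> nat) set"
  where "vars m \<Gamma> = (SIGMA \<nu>:ind \<Gamma>. gaps m \<Gamma> \<nu>)"

definition n_vars :: "nat \<Rightarrow> nat set \<Rightarrow> nat"
  where "n_vars m \<Gamma> = (\<Sum>\<nu>\<in>ind \<Gamma>. card (gaps m \<Gamma> \<nu>))"

definition n_eqs :: "nat \<Rightarrow> nat set \<Rightarrow> nat"
  where "n_eqs m \<Gamma> = (\<Sum>\<gamma>\<in>dec2 \<Gamma>. (card (Rel \<Gamma> \<gamma>) - 1) * card (gaps m \<Gamma> \<gamma>))"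

section \<open>Subalgebras of \<open>K[x]\<close>\<close>

definition subalg :: "'r::comm_ring_1 poly set \<Rightarrow> bool"
  where "subalg A \<longleftrightarrow> subring A ring_of_type_algebra \<and> (\<forall>c. [:c:] \<in> A)"

definition algs :: "nat \<Rightarrow> 'k::field poly set set"  (* \<A>(m) *)
  where "algs m = {A. subalg A \<and> (\<forall>g. monom 1 m * g \<in> A) \<and> monom 1 (m - 1) \<notin> A}"

definition Gamma_of :: "nat \<Rightarrow> 'k::field poly set \<Rightarrow> nat set"  (* \<Gamma>\<^sub>A *)
  where "Gamma_of m A =
    {\<gamma>. 1 \<le> \<gamma> \<and> \<gamma> \<le> m - 1 \<and> (\<exists>f\<in>A. coeff f \<gamma> = 1 \<and> (\<forall>i<\<gamma>. coeff f i = 0))}"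

definition algs_of :: "nat \<Rightarrow> nat set \<Rightarrow> 'k::field poly set set"  (* \<A>(m,\<Gamma>) *)
  where "algs_of m \<Gamma> = {A \<in> algs m. Gamma_of m A = \<Gamma>}"

text \<open>
  The algebra of regular functions of \<open>\<A>(m,\<Gamma>)\<close> has to be understood scheme-theoretically: over
  a finite field, or if the defining ideal is not radical, it is not an algebra of functions on
  the set of \<open>K\<close>-points. The points of \<open>\<A>(m,\<Gamma>)\<close> with values in a commutative ring \<open>R\<close> are the
  \<open>R\<close>-subalgebras of \<open>R[x]\<close> containing \<open>x\<^sup>m R[x]\<close> such that, for \<open>1 \<le> \<gamma> \<le> m - 1\<close>,
  the ideal of the \<open>r\<close> in \<open>R\<close> for which the algebra contains an element
  \<open>r x\<^sup>\<gamma> + (terms of higher degree)\<close> is the unit ideal if \<open>\<gamma>\<close> belongs to \<open>\<Gamma>\<close>, and the zero ideal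
  otherwise. By \<open>points_field\<close> below this is \<open>\<A>(m,\<Gamma>)\<close> if \<open>R = K\<close>. The point of using this form is
  that \<open>A / x\<^sup>m R[x]\<close> is again free with a canonical basis (cf. \<open>canonical_unique\<close>).
\<close>

definition low_coeffs :: "'r::comm_ring_1 poly set \<Rightarrow> nat \<Rightarrow> 'r set"
  where "low_coeffs A \<gamma> = {coeff f \<gamma> |f. f \<in> A \<and> (\<forall>i<\<gamma>. coeff f i = 0)}"

definition points :: "nat \<Rightarrow> nat set \<Rightarrow> 'r::comm_ring_1 poly set set"
  where "points m \<Gamma> = {A. subalg A \<and> (\<forall>g. monom 1 m * g \<in> A) \<and>
    (\<forall>\<gamma>\<in>{1..m - 1}. low_coeffs A \<gamma> = (if \<gamma> \<in> \<Gamma> then UNIV else {0}))}"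

text \<open>
  The classes of the canonical elements modulo \<open>x\<^sup>m R[x]\<close> are the canonical basis elements
  \<open>f\<^sub>\<gamma>\<close>; a canonical element is the representative of degree less than \<open>m\<close>.
\<close>

definition canonical :: "nat \<Rightarrow> nat set \<Rightarrow> 'r::comm_ring_1 poly set \<Rightarrow> nat \<Rightarrow> 'r poly \<Rightarrow> bool"
  where "canonical m \<Gamma> A \<gamma> f \<longleftrightarrow>
    f \<in> A \<and> (\<exists>l. f = monom 1 \<gamma> + (\<Sum>\<delta>\<in>gaps m \<Gamma> \<gamma>. monom (l \<delta>) \<delta>))"

definition basis_elem :: "nat \<Rightarrow> nat set \<Rightarrow> 'r::comm_ring_1 poly set \<Rightarrow> nat \<Rightarrow> 'r poly"
  where "basis_elem m \<Gamma> A \<gamma> = (THE f. canonical m \<Gamma> A \<gamma> f)"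

definition coords :: "nat \<Rightarrow> nat set \<Rightarrow> 'r::comm_ring_1 poly set \<Rightarrow> nat \<times> nat \<Rightarrow> 'r"
  where "coords m \<Gamma> A = (\<lambda>(\<nu>, j)\<in>vars m \<Gamma>. coeff (basis_elem m \<Gamma> A \<nu>) j)"

section \<open>The polynomial algebra \<open>P(m,\<Gamma>)\<close>\<close>

type_synonym 'k mpol = "((nat \<times> nat) \<Rightarrow>\<^sub>0 nat) \<Rightarrow>\<^sub>0 'k"

definition Var :: "nat \<times> nat \<Rightarrow> 'k::comm_ring_1 mpol"
  where "Var v = Poly_Mapping.single (Poly_Mapping.single v 1) 1"

definition Const :: "'k::comm_ring_1 \<Rightarrow> 'k mpol"
  where "Const c = Poly_Mapping.single 0 c"

definition evalm :: "(nat \<times> nat \<Rightarrow> 'k) \<Rightarrow> 'k::comm_ring_1 mpol \<Rightarrow> 'k"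
  where "evalm l p = (\<Sum>t\<in>Poly_Mapping.keys p. Poly_Mapping.lookup p t *
    (\<Prod>v\<in>Poly_Mapping.keys t. l v ^ Poly_Mapping.lookup t v))"

definition P_ring :: "nat \<Rightarrow> nat set \<Rightarrow> 'k::comm_ring_1 mpol ring"
  where "P_ring m \<Gamma> = ring_of_type_algebra
    \<lparr>carrier := {p. \<forall>t\<in>Poly_Mapping.keys p. Poly_Mapping.keys t \<subseteq> vars m \<Gamma>}\<rparr>"

section \<open>The defining relations\<close>

definition gen :: "nat \<Rightarrow> nat set \<Rightarrow> nat \<Rightarrow> 'k::comm_ring_1 mpol poly"
  where "gen m \<Gamma> \<nu> = monom 1 \<nu> + (\<Sum>j\<in>gaps m \<Gamma> \<nu>. monom (Var (\<nu>, j)) j)"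

definition gen_pow :: "nat \<Rightarrow> nat set \<Rightarrow> (nat \<Rightarrow> nat) \<Rightarrow> 'k::comm_ring_1 mpol poly"
  where "gen_pow m \<Gamma> a = (\<Prod>\<nu>\<in>ind \<Gamma>. gen m \<Gamma> \<nu> ^ a \<nu>)"

text \<open>
  The solution of the unitriangular system, by forward substitution; see \<open>theta_system\<close> and
  \<open>theta_unique\<close>. The argument \<open>a\<close> is the family of the chosen representations \<open>a(\<gamma>)\<close>.
\<close>

function theta :: "nat \<Rightarrow> nat set \<Rightarrow> (nat \<Rightarrow> nat \<Rightarrow> nat) \<Rightarrow> nat \<Rightarrow> (nat \<Rightarrow> nat) \<Rightarrow> nat \<Rightarrow>
    'k::comm_ring_1 mpol"
  where "theta m \<Gamma> a \<gamma> b \<gamma>' =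
    coeff (gen_pow m \<Gamma> b - gen_pow m \<Gamma> (a \<gamma>)) \<gamma>' -
    (\<Sum>\<gamma>''\<in>between \<Gamma> \<gamma> \<gamma>'. theta m \<Gamma> a \<gamma> b \<gamma>'' * coeff (gen_pow m \<Gamma> (a \<gamma>'')) \<gamma>')"
  by pat_completeness auto
termination
  by (relation "Wellfounded.measure (\<lambda>(_, _, _, _, _, \<gamma>'). \<gamma>')") (auto simp: between_def)

declare theta.simps [simp del]

definition relation :: "nat \<Rightarrow> nat set \<Rightarrow> (nat \<Rightarrow> nat \<Rightarrow> nat) \<Rightarrow> nat \<Rightarrow> (nat \<Rightarrow> nat) \<Rightarrow> nat \<Rightarrow>
    'k::comm_ring_1 mpol"
  where "relation m \<Gamma> a \<gamma> b j =
    coeff (gen_pow m \<Gamma> b) j -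
    (coeff (gen_pow m \<Gamma> (a \<gamma>)) j +
     (\<Sum>\<gamma>'\<in>above \<Gamma> \<gamma>. theta m \<Gamma> a \<gamma> b \<gamma>' * coeff (gen_pow m \<Gamma> (a \<gamma>')) j))"

definition rel_index ::
    "nat \<Rightarrow> nat set \<Rightarrow> (nat \<Rightarrow> nat \<Rightarrow> nat) \<Rightarrow> (nat \<times> (nat \<Rightarrow> nat) \<times> nat) set"
  where "rel_index m \<Gamma> a =
    {(\<gamma>, b, j). \<gamma> \<in> dec2 \<Gamma> \<and> b \<in> Rel \<Gamma> \<gamma> - {a \<gamma>} \<and> j \<in> gaps m \<Gamma> \<gamma>}"

definition relations :: "nat \<Rightarrow> nat set \<Rightarrow> (nat \<Rightarrow> nat \<Rightarrow> nat) \<Rightarrow> 'k::comm_ring_1 mpol set"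
  where "relations m \<Gamma> a = (\<lambda>(\<gamma>, b, j). relation m \<Gamma> a \<gamma> b j) ` rel_index m \<Gamma> a"

definition rel_ideal :: "nat \<Rightarrow> nat set \<Rightarrow> (nat \<Rightarrow> nat \<Rightarrow> nat) \<Rightarrow> 'k::comm_ring_1 mpol set"
  where "rel_ideal m \<Gamma> a = genideal (P_ring m \<Gamma>) (relations m \<Gamma> a)"

definition factor_alg :: "nat \<Rightarrow> nat set \<Rightarrow> (nat \<Rightarrow> nat \<Rightarrow> nat) \<Rightarrow> 'k::comm_ring_1 mpol set ring"
  where "factor_alg m \<Gamma> a = P_ring m \<Gamma> Quot rel_ideal m \<Gamma> a"

definition cls :: "nat \<Rightarrow> nat set \<Rightarrow> (nat \<Rightarrow> nat \<Rightarrow> nat) \<Rightarrow> 'k::comm_ring_1 mpol \<Rightarrow> 'k mpol set"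
  where "cls m \<Gamma> a p = rel_ideal m \<Gamma> a +>\<^bsub>P_ring m \<Gamma>\<^esub> p"

text \<open>
  For a ring homomorphism \<open>\<phi>\<close> making \<open>R\<close> a \<open>K\<close>-algebra: the \<open>K\<close>-algebra homomorphisms from the
  factor algebra to \<open>R\<close>, i.e. the \<open>R\<close>-points of the affine scheme it defines. They are made
  \<open>extensional\<close> so that equality of homomorphisms is equality on the carrier.
\<close>

definition alg_homs :: "('k::comm_ring_1 \<Rightarrow> 'r::comm_ring_1) \<Rightarrow> nat \<Rightarrow> nat set \<Rightarrow>
    (nat \<Rightarrow> nat \<Rightarrow> nat) \<Rightarrow> ('k mpol set \<Rightarrow> 'r) set"
  where "alg_homs \<phi> m \<Gamma> a =
    {h \<in> ring_hom (factor_alg m \<Gamma> a) ring_of_type_algebra \<inter> extensional (carrier (factor_alg m \<Gamma> a)).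
      \<forall>c. h (cls m \<Gamma> a (Const c)) = \<phi> c}"

definition hom_coords :: "nat \<Rightarrow> nat set \<Rightarrow> (nat \<Rightarrow> nat \<Rightarrow> nat) \<Rightarrow>
    ('k::comm_ring_1 mpol set \<Rightarrow> 'r) \<Rightarrow> nat \<times> nat \<Rightarrow> 'r"
  where "hom_coords m \<Gamma> a h = (\<lambda>v\<in>vars m \<Gamma>. h (cls m \<Gamma> a (Var v)))"

section \<open>Dimension\<close>

text \<open>The Krull dimension; it is \<open>-\<infinity>\<close> for the zero ring.\<close>

definition krull_dim :: "('a, 'b) ring_scheme \<Rightarrow> ereal"
  where "krull_dim R = (SUP d\<in>{d. \<exists>p :: nat \<Rightarrow> 'a set.
    (\<forall>i\<le>d. primeideal (p i) R) \<and> (\<forall>i<d. p i \<subset> p (Suc i))}. ereal (real d))"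

section \<open>Well-definedness\<close>

lemma theta_system:
  assumes "\<gamma>' \<in> above \<Gamma> \<gamma>"
  shows "theta m \<Gamma> a \<gamma> b \<gamma>' +
      (\<Sum>\<gamma>''\<in>between \<Gamma> \<gamma> \<gamma>'. theta m \<Gamma> a \<gamma> b \<gamma>'' * coeff (gen_pow m \<Gamma> (a \<gamma>'')) \<gamma>') =
    coeff (gen_pow m \<Gamma> b - gen_pow m \<Gamma> (a \<gamma>)) \<gamma>'"
  by (subst theta.simps) simp

lemma theta_unique:
  fixes t :: "nat \<Rightarrow> 'b::comm_ring_1 mpol"
  assumes sys: "\<And>\<gamma>'. \<gamma>' \<in> above \<Gamma> \<gamma> \<Longrightarrow>
      t \<gamma>' + (\<Sum>\<gamma>''\<in>between \<Gamma> \<gamma> \<gamma>'. t \<gamma>'' * coeff (gen_pow m \<Gamma> (a \<gamma>'')) \<gamma>') =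
      coeff (gen_pow m \<Gamma> b - gen_pow m \<Gamma> (a \<gamma>)) \<gamma>'"
    and "\<gamma>' \<in> above \<Gamma> \<gamma>"
  shows "t \<gamma>' = theta m \<Gamma> a \<gamma> b \<gamma>'"
  using assms(2)
proof (induction \<gamma>' rule: less_induct)
  case (less \<gamma>')
  define c where "c = (\<lambda>\<gamma>''. coeff (gen_pow m \<Gamma> (a \<gamma>'') :: 'b mpol poly) \<gamma>')"
  have IH: "t \<gamma>'' = theta m \<Gamma> a \<gamma> b \<gamma>''" if "\<gamma>'' \<in> between \<Gamma> \<gamma> \<gamma>'" for \<gamma>''
    by (rule less.IH) (use that in \<open>auto simp: between_def above_def\<close>)
  have "(\<Sum>\<gamma>''\<in>between \<Gamma> \<gamma> \<gamma>'. t \<gamma>'' * c \<gamma>'') =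
    (\<Sum>\<gamma>''\<in>between \<Gamma> \<gamma> \<gamma>'. theta m \<Gamma> a \<gamma> b \<gamma>'' * c \<gamma>'')"
    by (rule sum.cong[OF refl]) (simp only: IH)
  moreover have "t \<gamma>' + (\<Sum>\<gamma>''\<in>between \<Gamma> \<gamma> \<gamma>'. t \<gamma>'' * c \<gamma>'') =
    theta m \<Gamma> a \<gamma> b \<gamma>' + (\<Sum>\<gamma>''\<in>between \<Gamma> \<gamma> \<gamma>'. theta m \<Gamma> a \<gamma> b \<gamma>'' * c \<gamma>'')"
    unfolding c_def by (rule trans[OF sys[OF less.prems] theta_system[OF less.prems, of m a b, symmetric]])
  ultimately show ?case
    by (simp only: add_right_cancel)
qed

lemma subalgD:
  assumes "subalg A"
  shows "[:c:] \<in> A" "f \<in> A \<Longrightarrow> g \<in> A \<Longrightarrow> f + g \<in> A" "f \<in> A \<Longrightarrow> g \<in> A \<Longrightarrow> f * g \<in> A"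
    "f \<in> A \<Longrightarrow> smult c f \<in> A" "f \<in> A \<Longrightarrow> g \<in> A \<Longrightarrow> f - g \<in> A"
proof -
  have s: "subring A ring_of_type_algebra" and c: "\<And>c. [:c:] \<in> A"
    using assms by (auto simp: subalg_def)
  have add: "f + g \<in> A" if "f \<in> A" "g \<in> A" for f g
    using subringE(7)[OF s that] by (simp add: ring_of_type_algebra_def)
  have mult: "f * g \<in> A" if "f \<in> A" "g \<in> A" for f g
    using subringE(6)[OF s that] by (simp add: ring_of_type_algebra_def)
  have sm: "smult c f \<in> A" if "f \<in> A" for f c
    using mult[OF c[of c] that] by simp
  show "[:c:] \<in> A" "f \<in> A \<Longrightarrow> g \<in> A \<Longrightarrow> f + g \<in> A" "f \<in> A \<Longrightarrow> g \<in> A \<Longrightarrow> f * g \<in> A"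
    "f \<in> A \<Longrightarrow> smult c f \<in> A"
    using c add mult sm by auto
  show "f \<in> A \<Longrightarrow> g \<in> A \<Longrightarrow> f - g \<in> A"
    using add[of f "smult (- 1) g"] sm[of g "- 1"] by simp
qed

lemma points_field:
  assumes "4 \<le> m" "\<Gamma> \<in> semi_sets m"
  shows "points m \<Gamma> = (algs_of m \<Gamma> :: 'k::field poly set set)"
proof -
  have gam: "\<gamma> \<in> {1..m - 1}" "\<gamma> \<noteq> m - 1" if "\<gamma> \<in> \<Gamma>" for \<gamma>
  proof -
    have "\<gamma> \<in> {2..m - 2}"
      using that assms(2) unfolding semi_sets_def by blast
    then show "\<gamma> \<in> {1..m - 1}" "\<gamma> \<noteq> m - 1"
      using assms(1) by auto
  qed
  have low: "low_coeffs A \<gamma> = (if \<exists>f\<in>A. coeff f \<gamma> = 1 \<and> (\<forall>i<\<gamma>. coeff f i = 0) then UNIV else {0})"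
    (is "_ = (if ?P then _ else _)") if A: "subalg A" for A :: "'k poly set" and \<gamma>
  proof (cases ?P)
    case True
    then obtain f where f: "f \<in> A" "coeff f \<gamma> = 1" "\<forall>i<\<gamma>. coeff f i = 0"
      by auto
    have "c \<in> low_coeffs A \<gamma>" for c
      unfolding low_coeffs_def
      by (rule CollectI, rule exI[of _ "smult c f"]) (use f subalgD(4)[OF A] in auto)
    then show ?thesis
      using True by auto
  next
    case False
    have "coeff f \<gamma> = 0" if f: "f \<in> A" "\<forall>i<\<gamma>. coeff f i = 0" for f
    proof (rule ccontr)
      assume "coeff f \<gamma> \<noteq> 0"
      then have ?P
        by (intro bexI[of _ "smult (inverse (coeff f \<gamma>)) f"]) (use f subalgD(4)[OF A] in auto)
      then show False
        using False by blast
    qed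
    moreover have "0 \<in> low_coeffs A \<gamma>"
      unfolding low_coeffs_def
      by (rule CollectI, rule exI[of _ 0]) (use subalgD(1)[OF A, of 0] in auto)
    ultimately have "low_coeffs A \<gamma> = {0}"
      unfolding low_coeffs_def by blast
    then show ?thesis
      using False by (simp only: if_False)
  qed
  have iff: "(\<forall>\<gamma>\<in>{1..m - 1}. low_coeffs A \<gamma> = (if \<gamma> \<in> \<Gamma> then UNIV else {0})) \<longleftrightarrow>
      monom 1 (m - 1) \<notin> A \<and> Gamma_of m A = \<Gamma>"
    if A: "subalg A" for A :: "'k poly set"
  proof -
    have ne: "UNIV \<noteq> {0 :: 'k}"
      by (metis UNIV_I singletonD zero_neq_one)
    have "(\<forall>\<gamma>\<in>{1..m - 1}. low_coeffs A \<gamma> = (if \<gamma> \<in> \<Gamma> then UNIV else {0})) \<longleftrightarrow>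
      (\<forall>\<gamma>\<in>{1..m - 1}. \<gamma> \<in> Gamma_of m A \<longleftrightarrow> \<gamma> \<in> \<Gamma>)"
      unfolding low[OF A] Gamma_of_def using ne by (intro ball_cong refl) auto
    also have "\<dots> \<longleftrightarrow> Gamma_of m A = \<Gamma>"
      using gam(1) by (auto simp: Gamma_of_def)
    also have "\<dots> \<longleftrightarrow> monom 1 (m - 1) \<notin> A \<and> Gamma_of m A = \<Gamma>"
    proof -
      have "m - 1 \<in> Gamma_of m A" if "monom 1 (m - 1) \<in> A"
        using that assms(1) by (auto simp: Gamma_of_def intro!: bexI[of _ "monom 1 (m - 1)"])
      then show ?thesis
        using gam(2) by blast
    qed
    finally show ?thesis .
  qed
  show ?thesis
    unfolding points_def algs_of_def algs_def using iff by blast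
qed

lemma canonical_unique:
  fixes A :: "'r::comm_ring_1 poly set"
  assumes A: "A \<in> points m \<Gamma>" and \<Gamma>: "4 \<le> m" "\<Gamma> \<in> semi_sets m" and \<gamma>: "\<gamma> \<in> \<Gamma>"
  shows "\<exists>!f. canonical m \<Gamma> A \<gamma> f"
proof -
  have sub: "subalg A" and xm: "\<And>g. monom 1 m * g \<in> A"
    and low: "\<And>i. i \<in> {1..m - 1} \<Longrightarrow> low_coeffs A i = (if i \<in> \<Gamma> then UNIV else {0})"
    using A by (auto simp: points_def)
  have gam: "i \<in> {1..m - 1}" if "i \<in> \<Gamma>" for i
  proof -
    have "i \<in> {2..m - 2}"
      using that \<Gamma>(2) unfolding semi_sets_def by blast
    then show ?thesis
      by auto
  qed
  have fin: "finite (gaps m \<Gamma> \<gamma>)"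
    by (rule finite_subset[of _ "{..m}"]) (auto simp: gaps_def)
  have cf: "coeff (monom 1 \<gamma> + (\<Sum>\<delta>\<in>gaps m \<Gamma> \<gamma>. monom (l \<delta>) \<delta>)) i =
      (if i = \<gamma> then 1 else if i \<in> gaps m \<Gamma> \<gamma> then l i else 0)" for l :: "nat \<Rightarrow> 'r" and i
    using fin by (auto simp: coeff_sum gaps_def)
  have lead: "\<exists>g\<in>A. coeff g i = 1 \<and> (\<forall>j<i. coeff g j = 0)" if i: "i \<in> \<Gamma>" for i
  proof -
    have "1 \<in> low_coeffs A i"
      using low[OF gam[OF i]] i by simp
    then show ?thesis
      by (force simp: low_coeffs_def)
  qed
  have red: "\<exists>f\<in>A. coeff f \<gamma> = 1 \<and> (\<forall>j<\<gamma>. coeff f j = 0) \<and> (\<forall>j\<in>between \<Gamma> \<gamma> k. coeff f j = 0)" for k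
  proof (induction k)
    case 0
    show ?case
      using lead[OF \<gamma>] by (auto simp: between_def)
  next
    case (Suc k)
    then obtain f where f: "f \<in> A" "coeff f \<gamma> = 1" "\<forall>j<\<gamma>. coeff f j = 0"
      "\<forall>j\<in>between \<Gamma> \<gamma> k. coeff f j = 0"
      by auto
    show ?case
    proof (cases "k \<in> \<Gamma> \<and> \<gamma> < k")
      case False
      then have "between \<Gamma> \<gamma> (Suc k) = between \<Gamma> \<gamma> k"
        by (auto simp: between_def less_Suc_eq)
      then show ?thesis
        using f by auto
    next
      case True
      then obtain g where g: "g \<in> A" "coeff g k = 1" "\<forall>j<k. coeff g j = 0"
        using lead by blast
      show ?thesis
      proof (rule bexI[of _ "f - smult (coeff f k) g"])
        show "f - smult (coeff f k) g \<in> A"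
          using f g subalgD(4,5)[OF sub] by auto
      qed (use f g True in \<open>auto simp: between_def less_Suc_eq\<close>)
    qed
  qed
  obtain f where f: "f \<in> A" "coeff f \<gamma> = 1" "\<forall>j<\<gamma>. coeff f j = 0"
    "\<forall>j\<in>between \<Gamma> \<gamma> m. coeff f j = 0"
    using red by blast
  define f' where "f' = monom 1 \<gamma> + (\<Sum>\<delta>\<in>gaps m \<Gamma> \<gamma>. monom (coeff f \<delta>) \<delta>)"
  have "f' = f - monom 1 m * poly_shift m f"
  proof (rule poly_eqI)
    fix i
    have "\<gamma> < m"
      using gam[OF \<gamma>] \<Gamma>(1) by auto
    have "coeff f i = 0" if "i < m" "i \<noteq> \<gamma>" "i \<notin> gaps m \<Gamma> \<gamma>"
    proof (cases "i < \<gamma>")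
      case False
      then have "i \<in> between \<Gamma> \<gamma> m"
        using that by (auto simp: between_def gaps_def)
      then show ?thesis
        using f(4) by blast
    qed (use f in auto)
    moreover have "i \<notin> gaps m \<Gamma> \<gamma>" if "m \<le> i"
      using that \<Gamma>(1) by (auto simp: gaps_def)
    ultimately show "coeff f' i = coeff (f - monom 1 m * poly_shift m f) i"
      unfolding f'_def cf
      using f(2) \<open>\<gamma> < m\<close> by (auto simp: coeff_monom_mult coeff_poly_shift)
  qed
  then have "f' \<in> A"
    using f(1) xm subalgD(5)[OF sub] by simp
  then have ex: "canonical m \<Gamma> A \<gamma> f'"
    by (auto simp: canonical_def f'_def intro: exI[of _ "coeff f"])
  have "f = g" if fg: "canonical m \<Gamma> A \<gamma> f" "canonical m \<Gamma> A \<gamma> g" for f g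
  proof (rule poly_eqI)
    fix i
    have inA: "f - g \<in> A"
      using fg subalgD(5)[OF sub] by (auto simp: canonical_def)
    have zero: "coeff (f - g) i = 0" if "i \<notin> gaps m \<Gamma> \<gamma>" for i
    proof -
      obtain l l' where "f = monom 1 \<gamma> + (\<Sum>\<delta>\<in>gaps m \<Gamma> \<gamma>. monom (l \<delta>) \<delta>)"
        "g = monom 1 \<gamma> + (\<Sum>\<delta>\<in>gaps m \<Gamma> \<gamma>. monom (l' \<delta>) \<delta>)"
        using fg unfolding canonical_def by blast
      then have "coeff f i = coeff g i"
        using that by (simp only: cf if_False)
      then show ?thesis
        by simp
    qed
    have "coeff (f - g) i = 0"
    proof (induction i rule: less_induct)
      case (less i)
      show ?case
      proof (cases "i \<in> gaps m \<Gamma> \<gamma>")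
        case True
        have "coeff (f - g) i \<in> low_coeffs A i"
          unfolding low_coeffs_def
          by (rule CollectI, rule exI[of _ "f - g"]) (use less inA in auto)
        moreover have "low_coeffs A i = {0}"
          using True low[of i] by (auto simp: gaps_def)
        ultimately show ?thesis
          by auto
      qed (rule zero)
    qed
    then show "coeff f i = coeff g i"
      by simp
  qed
  then show ?thesis
    using ex by blast
qed

end

theory Submission
  imports Defs "HOL-Library.Product_Lexorder" "HOL-Library.Function_Algebras"
begin

text \<open>
  Specialise the variables to values \<open>l\<close> in a ring \<open>R\<close>. The \<open>R\<close>-module spanned by \<open>1\<close>, the
  specialisations of \<open>f\<^bsup>a(\<gamma>)\<^esup>\<close> for \<open>\<gamma> \<in> \<Gamma>\<close>, and \<open>x\<^sup>m R[x]\<close> is closed under multiplication as soon as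
  it contains \<open>f\<^sup>b\<close> for all \<open>b \<in> Rel(\<gamma>)\<close>, \<open>\<gamma> \<in> dec(\<Gamma>)\<close>. The polynomials \<open>\<theta>\<close> are the only possible
  coefficients of \<open>f\<^sup>b - f\<^bsup>a(\<gamma>)\<^esup>\<close> with respect to the \<open>f\<^bsup>a(\<gamma>')\<^esup>\<close>, \<open>\<gamma>' > \<gamma>\<close>, and the relations say that
  with these coefficients also the terms in the gaps agree. Conversely a point contains the
  difference of the two sides, and an element without terms in degrees from \<open>\<Gamma> \<union> {0}\<close> lies in
  \<open>x\<^sup>m R[x]\<close>.

  The relations have no constant term, so for the bound on the dimension it suffices to show that
  \<open>K[x\<^sub>1, \<dots>, x\<^sub>n] / (F)\<close> has a chain of primes of length \<open>r = n - card F\<close> if the elements of \<open>F\<close>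
  vanish at the origin. By the Coquand-Lombardi description of the Krull dimension, a sequence
  \<open>y\<^sub>1, \<dots>, y\<^sub>r\<close> yields such a chain unless \<open>0\<close> is of the form
  \<open>y\<^sub>1\<^bsup>k(1)\<^esup> (y\<^sub>2\<^bsup>k(2)\<^esup> (\<cdots> (y\<^sub>r\<^bsup>k(r)\<^esup> (1 + c\<^sub>r y\<^sub>r)) \<cdots>) + c\<^sub>1 y\<^sub>1)\<close>. If this happens for
  every set of \<open>r\<close> variables, then \<open>(F)\<close> contains, for each such set, an element
  whose lexicographically smallest monomial involves only these variables. Using these elements
  as rewrite rules modulo terms of degree at least \<open>d\<close>, all polynomials are combinations of
  \<open>O(d\<^bsup>r - 1\<^esup>)\<close> monomials times \<open>O(d\<^bsup>card F\<^esup>)\<close> products of elements of \<open>F\<close>, whereas there are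
  of the order of \<open>d\<^sup>n\<close> monomials of degree less than \<open>d\<close>.
\<close>

section \<open>Chains of prime ideals\<close>

text \<open>The iterated boundary monoid of Coquand and Lombardi.\<close>

fun boundary :: "('a, 'b) ring_scheme \<Rightarrow> 'a list \<Rightarrow> 'a set"
  where
    "boundary R [] = {\<one>\<^bsub>R\<^esub>}"
  | "boundary R (y # ys) = {y [^]\<^bsub>R\<^esub> n \<otimes>\<^bsub>R\<^esub> (s \<oplus>\<^bsub>R\<^esub> y \<otimes>\<^bsub>R\<^esub> r) |(n :: nat) s r.
      s \<in> boundary R ys \<and> r \<in> carrier R}"

context cring
begin

lemma boundary_carrier: "set ys \<subseteq> carrier R \<Longrightarrow> boundary R ys \<subseteq> carrier R"
  by (induction ys) auto

lemma boundary_ConsI: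
  assumes "s \<in> boundary R ys" "r \<in> carrier R" "set (y # ys) \<subseteq> carrier R"
  shows "s \<oplus> y \<otimes> r \<in> boundary R (y # ys)"
proof -
  have "s \<oplus> y \<otimes> r = y [^] (0 :: nat) \<otimes> (s \<oplus> y \<otimes> r)"
    using assms boundary_carrier[of ys] by auto
  then show ?thesis
    using assms(1,2) unfolding boundary.simps by blast
qed

lemma boundary_one: "set ys \<subseteq> carrier R \<Longrightarrow> \<one> \<in> boundary R ys"
proof (induction ys)
  case (Cons y ys)
  then show ?case
    using boundary_ConsI[of \<one> ys \<zero> y] by simp
qed simp

lemma boundary_hd: "set (y # ys) \<subseteq> carrier R \<Longrightarrow> y \<in> boundary R (y # ys)"
proof -
  assume y: "set (y # ys) \<subseteq> carrier R"
  then have "y = y [^] (1 :: nat) \<otimes> (\<one> \<oplus> y \<otimes> \<zero>)" "\<one> \<in> boundary R ys" "\<zero> \<in> carrier R"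
    using boundary_one by auto
  then show ?thesis
    unfolding boundary.simps by blast
qed

text \<open>In a product of two factors \<open>s + y r\<close> all terms divisible by
  \<open>y\<close> merge into one multiple \<open>y r''\<close>, so the shape survives. The boundary
  is therefore a multiplicative set that a prime ideal can avoid.\<close>

lemma boundary_mult:
  assumes "set ys \<subseteq> carrier R" "x \<in> boundary R ys" "x' \<in> boundary R ys"
  shows "x \<otimes> x' \<in> boundary R ys"
  using assms
proof (induction ys arbitrary: x x')
  case (Cons y ys)
  obtain n :: nat and s r where x: "x = y [^] n \<otimes> (s \<oplus> y \<otimes> r)" "s \<in> boundary R ys" "r \<in> carrier R"
    using Cons.prems(2) by auto
  obtain n' :: nat and s' r' where x': "x' = y [^] n' \<otimes> (s' \<oplus> y \<otimes> r')" "s' \<in> boundary R ys" "r' \<in> carrier R"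
    using Cons.prems(3) by auto
  have c: "y \<in> carrier R" "s \<in> carrier R" "s' \<in> carrier R"
    using Cons.prems(1) x(2) x'(2) boundary_carrier[of ys] by auto
  have c': "y [^] n \<in> carrier R" "y [^] n' \<in> carrier R"
    using c by auto
  define r'' where "r'' = s \<otimes> r' \<oplus> r \<otimes> s' \<oplus> y \<otimes> r \<otimes> r'"
  have "x \<otimes> x' = (y [^] n \<otimes> y [^] n') \<otimes> (s \<otimes> s' \<oplus> y \<otimes> r'')"
    unfolding x x' r''_def using c c' x(3) x'(3) by algebra
  also have "y [^] n \<otimes> y [^] n' = y [^] (n + n')"
    using c by (simp add: nat_pow_mult)
  finally have "x \<otimes> x' = y [^] (n + n') \<otimes> (s \<otimes> s' \<oplus> y \<otimes> r'')" .
  moreover have "s \<otimes> s' \<in> boundary R ys" "r'' \<in> carrier R"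
    using Cons.IH[OF _ x(2) x'(2)] Cons.prems(1) c x(3) x'(3) by (auto simp: r''_def)
  ultimately show ?case
    unfolding boundary.simps by blast
qed simp

text \<open>Krull's separation lemma: Zorn yields an ideal maximal among those containing
  \<open>I\<close> and disjoint from \<open>S\<close>, and such an ideal is prime. It is proper
  because \<open>S\<close> contains the unit.\<close>

lemma exists_primeideal_disjoint:
  assumes I: "ideal I R" and dis: "I \<inter> S = {}" and S: "\<one> \<in> S"
    and mult: "\<And>x y. x \<in> S \<Longrightarrow> y \<in> S \<Longrightarrow> x \<otimes> y \<in> S"
  shows "\<exists>P. primeideal P R \<and> I \<subseteq> P \<and> P \<inter> S = {}"
proof -
  define Fam where "Fam = {J. ideal J R \<and> I \<subseteq> J \<and> J \<inter> S = {}}"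
  have "\<exists>M\<in>Fam. \<forall>J\<in>Fam. M \<subseteq> J \<longrightarrow> J = M"
  proof (rule subset_Zorn)
    fix C assume C: "subset.chain Fam C"
    show "\<exists>U\<in>Fam. \<forall>J\<in>C. J \<subseteq> U"
    proof (cases "C = {}")
      case True
      then show ?thesis
        using I dis by (auto simp: Fam_def)
    next
      case False
      have "subset.chain {J. ideal J R} C"
        using C unfolding pred_on.chain_def Fam_def by auto
      then have "ideal (\<Union>C) R"
        using chain_Union_is_ideal[of C] False by simp
      moreover have "I \<subseteq> \<Union>C" "\<Union>C \<inter> S = {}"
        using C False unfolding pred_on.chain_def Fam_def by blast+
      ultimately show ?thesis
        by (auto simp: Fam_def)
    qed
  qed
  then obtain M where MF: "M \<in> Fam" "\<forall>J\<in>Fam. M \<subseteq> J \<longrightarrow> J = M"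
    by (rule bexE)
  have M: "ideal M R" "I \<subseteq> M" "M \<inter> S = {}"
    using MF(1) by (auto simp: Fam_def)
  have max: "J = M" if "ideal J R" "M \<subseteq> J" "J \<inter> S = {}" for J
  proof -
    have "J \<in> Fam"
      using that M(2) by (auto simp: Fam_def)
    then show ?thesis
      using MF(2) that(2) by blast
  qed
  interpret M: ideal M R
    by (rule M(1))
  \<comment> \<open>By maximality, adjoining any \<open>a\<close> outside \<open>M\<close> produces
    an ideal that meets \<open>S\<close>.\<close>
  have hit: "\<exists>k\<in>M. \<exists>r\<in>carrier R. k \<oplus> r \<otimes> a \<in> S" if a: "a \<in> carrier R" "a \<notin> M" for a
  proof -
    have id: "ideal (M <+>\<^bsub>R\<^esub> PIdl a) R"
      by (intro add_ideals M(1) cgenideal_ideal a)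
    have "k \<in> M <+>\<^bsub>R\<^esub> PIdl a" if "k \<in> M" for k
    proof -
      have "k = k \<oplus> \<zero> \<otimes> a"
        using that a M.Icarr by simp
      then show ?thesis
        using that unfolding set_add_def' cgenideal_def by blast
    qed
    moreover have "a \<in> M <+>\<^bsub>R\<^esub> PIdl a"
    proof -
      have "a = \<zero> \<oplus> \<one> \<otimes> a"
        using a by simp
      then show ?thesis
        using M.zero_closed unfolding set_add_def' cgenideal_def by blast
    qed
    ultimately have "(M <+>\<^bsub>R\<^esub> PIdl a) \<inter> S \<noteq> {}"
      using max[OF id] a(2) by blast
    then show ?thesis
      unfolding set_add_def' cgenideal_def by blast
  qed
  have "primeideal M R"
  proof (rule primeidealI[OF M(1) is_cring])
    show "carrier R \<noteq> M"
      using S M(3) by blast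
    fix a b assume ab: "a \<in> carrier R" "b \<in> carrier R" "a \<otimes> b \<in> M"
    show "a \<in> M \<or> b \<in> M"
    proof (rule ccontr)
      assume "\<not> (a \<in> M \<or> b \<in> M)"
      then obtain k r k' r' where k: "k \<in> M" "r \<in> carrier R" "k \<oplus> r \<otimes> a \<in> S"
        "k' \<in> M" "r' \<in> carrier R" "k' \<oplus> r' \<otimes> b \<in> S"
        using hit ab by meson
      have kc: "k \<in> carrier R" "k' \<in> carrier R"
        using k M.Icarr by auto
      \<comment> \<open>The left side is a product of two elements of \<open>S\<close>, while every
        summand on the right lies in \<open>M\<close>.\<close>
      have "(k \<oplus> r \<otimes> a) \<otimes> (k' \<oplus> r' \<otimes> b) =
        k \<otimes> (k' \<oplus> r' \<otimes> b) \<oplus> (r \<otimes> a) \<otimes> k' \<oplus> (r \<otimes> r') \<otimes> (a \<otimes> b)"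
        using k(2,5) kc ab by algebra
      also have "\<dots> \<in> M"
      proof -
        have "k \<otimes> (k' \<oplus> r' \<otimes> b) \<in> M" "(r \<otimes> a) \<otimes> k' \<in> M" "(r \<otimes> r') \<otimes> (a \<otimes> b) \<in> M"
          using k(1,2,4,5) kc ab M.I_l_closed M.I_r_closed by simp_all
        then show ?thesis
          by (intro M.a_closed)
      qed
      finally show False
        using mult[OF k(3,6)] M(3) by blast
    qed
  qed
  then show ?thesis
    using M by blast
qed

text \<open>
  A prime \<open>P\<close> maximal with respect to being disjoint from \<open>boundary R (y # ys)\<close> does not contain
  \<open>y\<close>, and \<open>P + (y)\<close> is still disjoint from \<open>boundary R ys\<close>.
\<close>

lemma prime_chain:
  assumes "set ys \<subseteq> carrier R" "ideal I R" "I \<inter> boundary R ys = {}"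
  shows "\<exists>p. (\<forall>i\<le>length ys. primeideal (p i) R) \<and> (\<forall>i<length ys. p i \<subset> p (Suc i)) \<and> I \<subseteq> p 0"
  using assms
proof (induction ys arbitrary: I)
  case Nil
  obtain P where "primeideal P R" "I \<subseteq> P"
    using exists_primeideal_disjoint[OF Nil(2,3)] by auto
  then show ?case
    by (intro exI[of _ "\<lambda>_. P"]) auto
next
  case (Cons y ys)
  have y: "y \<in> carrier R" and ys: "set ys \<subseteq> carrier R"
    using Cons.prems(1) by auto
  obtain P where P: "primeideal P R" "I \<subseteq> P" "P \<inter> boundary R (y # ys) = {}"
    using exists_primeideal_disjoint[OF Cons.prems(2,3) boundary_one[OF Cons.prems(1)]]
      boundary_mult[OF Cons.prems(1)] by blast
  interpret P: primeideal P R
    by (rule P(1))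
  define J where "J = P <+>\<^bsub>R\<^esub> PIdl y"
  have J: "ideal J R"
    unfolding J_def by (intro add_ideals P.is_ideal cgenideal_ideal y)
  have "J \<inter> boundary R ys = {}"
  proof (rule ccontr)
    assume "J \<inter> boundary R ys \<noteq> {}"
    then obtain k r where k: "k \<in> P" "r \<in> carrier R" "k \<oplus> r \<otimes> y \<in> boundary R ys"
      unfolding J_def set_add_def' cgenideal_def by blast
    \<comment> \<open>An element of \<open>J\<close> in the boundary of \<open>ys\<close> differs
      from an element of \<open>P\<close> by a multiple of \<open>y\<close>, which puts the latter
      into the boundary of \<open>y # ys\<close>.\<close>
    have "k = (k \<oplus> r \<otimes> y) \<oplus> y \<otimes> (\<ominus> r)"
      using k(2) P.Icarr[OF k(1)] y by algebra
    also have "\<dots> \<in> boundary R (y # ys)"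
      using k Cons.prems(1) by (intro boundary_ConsI) auto
    finally show False
      using k(1) P(3) by blast
  qed
  then obtain p where p: "\<forall>i\<le>length ys. primeideal (p i) R" "\<forall>i<length ys. p i \<subset> p (Suc i)" "J \<subseteq> p 0"
    using Cons.IH[OF ys J] by blast
  have "P \<subseteq> J"
  proof
    fix k assume "k \<in> P"
    moreover have "k = k \<oplus> \<zero> \<otimes> y"
      using P.Icarr[OF \<open>k \<in> P\<close>] y by simp
    ultimately show "k \<in> J"
      unfolding J_def set_add_def' cgenideal_def by blast
  qed
  moreover have "y \<in> J"
  proof -
    have "y = \<zero> \<oplus> \<one> \<otimes> y"
      using y by simp
    then show ?thesis
      using P.zero_closed unfolding J_def set_add_def' cgenideal_def by blast
  qed
  moreover have "y \<notin> P"
    using P(3) boundary_hd[OF Cons.prems(1)] by blast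
  ultimately have "P \<subset> p 0"
    using p(3) by blast
  show ?case
  proof (intro exI[of _ "case_nat P p"] conjI allI impI)
    show "primeideal (case i of 0 \<Rightarrow> P | Suc x \<Rightarrow> p x) R" if "i \<le> length (y # ys)" for i
      using that p(1) P(1) by (cases i) auto
    show "(case i of 0 \<Rightarrow> P | Suc x \<Rightarrow> p x) \<subset> (case Suc i of 0 \<Rightarrow> P | Suc x \<Rightarrow> p x)"
      if "i < length (y # ys)" for i
      using that p(2) \<open>P \<subset> p 0\<close> by (cases i) auto
    show "I \<subseteq> (case 0 of 0 \<Rightarrow> P | Suc x \<Rightarrow> p x)"
      using P(2) by simp
  qed
qed

end

text \<open>Serves to lift a zero in the boundary of a quotient ring to an element of the ideal in
  the boundary upstairs. The multipliers \<open>r\<close> are free ring elements, so surjectivity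
  lifts them one by one.\<close>

lemma boundary_hom:
  assumes h: "h \<in> ring_hom R S" and surj: "h ` carrier R = carrier S" and R: "ring R" "ring S"
    and "set ys \<subseteq> carrier R" "x \<in> boundary S (map h ys)"
  shows "\<exists>s\<in>boundary R ys \<inter> carrier R. h s = x"
  using assms(5,6)
proof (induction ys arbitrary: x)
  case Nil
  then show ?case
    using ring_hom_one[OF h] ring.ring_simprules(6)[OF R(1)] by auto
next
  case (Cons y ys)
  interpret R: ring R by fact
  interpret S: ring S by fact
  obtain n :: nat and s r where x: "x = h y [^]\<^bsub>S\<^esub> n \<otimes>\<^bsub>S\<^esub> (s \<oplus>\<^bsub>S\<^esub> h y \<otimes>\<^bsub>S\<^esub> r)"
    "s \<in> boundary S (map h ys)" "r \<in> carrier S"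
    using Cons.prems(2) by auto
  obtain s' r' where s: "s' \<in> boundary R ys" "s' \<in> carrier R" "h s' = s" "r' \<in> carrier R" "h r' = r"
  proof -
    obtain s' where "s' \<in> boundary R ys \<inter> carrier R" "h s' = s"
      using Cons.IH[OF _ x(2)] Cons.prems(1) by auto
    moreover obtain r' where "r' \<in> carrier R" "h r' = r"
      using x(3) unfolding surj[symmetric] by blast
    ultimately show ?thesis
      using that by blast
  qed
  have y: "y \<in> carrier R"
    using Cons.prems(1) by simp
  have "h (y [^]\<^bsub>R\<^esub> n) = h y [^]\<^bsub>S\<^esub> n"
    using ring_hom_ring.hom_nat_pow[OF ring_hom_ringI2[OF R h] y] by blast
  then have "h (y [^]\<^bsub>R\<^esub> n \<otimes>\<^bsub>R\<^esub> (s' \<oplus>\<^bsub>R\<^esub> y \<otimes>\<^bsub>R\<^esub> r')) = x"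
    unfolding x(1) using s y h by (simp add: ring_hom_mult ring_hom_add)
  moreover have "y [^]\<^bsub>R\<^esub> n \<otimes>\<^bsub>R\<^esub> (s' \<oplus>\<^bsub>R\<^esub> y \<otimes>\<^bsub>R\<^esub> r') \<in> boundary R (y # ys) \<inter> carrier R"
    using s y by auto
  ultimately show ?case
    by blast
qed

section \<open>Lexicographic reduction and counting monomials\<close>

abbreviation "lookup \<equiv> Poly_Mapping.lookup"
abbreviation "keys \<equiv> Poly_Mapping.keys"
abbreviation "single \<equiv> Poly_Mapping.single"

lemma lookup_single_times:
  fixes p :: "'a::cancel_comm_monoid_add \<Rightarrow>\<^sub>0 'b::comm_semiring_1"
  shows "lookup (single w c * p) (w + t) = c * lookup p t"
proof -
  have "lookup (single w c * p) (w + t) =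
    (\<Sum>l. (c * (\<Sum>q. lookup p q when w + t = l + q)) when w = l)"
    by (simp add: lookup_mult lookup_single when_mult)
  also have "\<dots> = c * (\<Sum>q. lookup p q when t = q)"
    by simp
  also have "\<dots> = c * lookup p t"
    by (subst Sum_any_when_equal') simp
  finally show ?thesis .
qed

lemma keys_single_times:
  "u \<in> keys (single w c * p) \<Longrightarrow> \<exists>t\<in>keys p. u = w + t"
  using keys_mult[of "single w c" p] by (auto split: if_splits)

lemma poly_mapping_sum_single: "(\<Sum>t\<in>keys p. single t (lookup p t)) = p"
proof (rule poly_mapping_eqI)
  fix k
  show "lookup (\<Sum>t\<in>keys p. single t (lookup p t)) k = lookup p k"
    by (cases "k \<in> keys p") (auto simp: lookup_sum lookup_single when_def in_keys_iff)
qed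

section \<open>Total degree, order and lexicographically initial monomials\<close>

definition tdeg :: "('x \<Rightarrow>\<^sub>0 nat) \<Rightarrow> nat"
  where "tdeg t = (\<Sum>v\<in>keys t. lookup t v)"

lemma tdeg_superset:
  assumes "finite V" "keys t \<subseteq> V"
  shows "tdeg t = (\<Sum>v\<in>V. lookup t v)"
  unfolding tdeg_def by (rule sum.mono_neutral_left) (use assms in \<open>auto simp: in_keys_iff\<close>)

lemma tdeg_add: "tdeg (s + t) = tdeg s + tdeg t"
proof -
  have "finite (keys s \<union> keys t)"
    by simp
  note * = tdeg_superset[OF this]
  show ?thesis
    using keys_add[of s t] by (simp add: * lookup_add sum.distrib)
qed

lemma tdeg_eq_0: "tdeg t = 0 \<Longrightarrow> t = 0"
  by (intro poly_mapping_eqI) (auto simp: tdeg_def in_keys_iff)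

definition ord_ge :: "nat \<Rightarrow> (('x \<Rightarrow>\<^sub>0 nat) \<Rightarrow>\<^sub>0 'k::comm_ring_1) \<Rightarrow> bool"
  where "ord_ge k p \<longleftrightarrow> (\<forall>t\<in>keys p. k \<le> tdeg t)"

lemma ord_ge_mult: "ord_ge j p \<Longrightarrow> ord_ge k q \<Longrightarrow> ord_ge (j + k) (p * q)"
  using keys_mult[of p q] by (fastforce simp: ord_ge_def tdeg_add intro: add_mono)

lemma ord_ge_power: "ord_ge j p \<Longrightarrow> ord_ge (n * j) (p ^ n)"
  by (induction n) (auto simp: ord_ge_mult, simp add: ord_ge_def)

lemma ord_ge_prod:
  "finite F \<Longrightarrow> (\<And>f. f \<in> F \<Longrightarrow> ord_ge (k f) (p f)) \<Longrightarrow> ord_ge (\<Sum>f\<in>F. k f) (\<Prod>f\<in>F. p f)"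
  by (induction F rule: finite_induct) (auto simp: ord_ge_mult, simp add: ord_ge_def)

definition polys :: "'x set \<Rightarrow> (('x \<Rightarrow>\<^sub>0 nat) \<Rightarrow>\<^sub>0 'k::comm_ring_1) set"
  where "polys V = {p. \<forall>t\<in>keys p. keys t \<subseteq> V}"

text \<open>Initial means smallest: rewriting replaces a monomial by larger ones and stops because
  only finitely many monomials stay below the degree bound. Coefficient 1 makes such a polynomial
  directly usable as a rewrite rule.\<close>

definition lex_initial :: "('x::linorder \<Rightarrow>\<^sub>0 nat) \<Rightarrow> (('x \<Rightarrow>\<^sub>0 nat) \<Rightarrow>\<^sub>0 'k::comm_ring_1) \<Rightarrow> bool"
  where "lex_initial t p \<longleftrightarrow> lookup p t = 1 \<and> (\<forall>u\<in>keys p. t \<le> u)"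

text \<open>At the smallest key of \<open>u\<close>, which is at most \<open>v\<close>,
  \<open>t\<close> still vanishes, and before it both vanish.\<close>

lemma lex_less:
  fixes t u :: "'x::linorder \<Rightarrow>\<^sub>0 nat"
  assumes "\<And>v'. v' \<le> v \<Longrightarrow> lookup t v' = 0" "lookup u v \<noteq> 0"
  shows "t < u"
proof -
  define v0 where "v0 = Min (keys u)"
  have ne: "keys u \<noteq> {}" "v \<in> keys u"
    using assms(2) by (auto simp: in_keys_iff)
  have "v0 \<in> keys u" "v0 \<le> v"
    unfolding v0_def using ne by auto
  moreover have "lookup u v' = 0" if "v' < v0" for v'
    using that ne unfolding v0_def by (auto simp: in_keys_iff[symmetric] not_in_keys_iff_lookup_eq_zero[symmetric])
  ultimately have "lookup t v0 < lookup u v0" "\<forall>v'<v0. lookup t v' = lookup u v'"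
    using assms(1) by (auto simp: in_keys_iff)
  then show ?thesis
    by (auto simp: less_poly_mapping.rep_eq less_fun_def)
qed

lemma lex_initial_times_single:
  fixes p :: "('x::linorder \<Rightarrow>\<^sub>0 nat) \<Rightarrow>\<^sub>0 'k::comm_ring_1"
  assumes "lex_initial t p"
  shows "lex_initial (w + t) (single w 1 * p)"
  using assms keys_single_times[of _ w 1 p] unfolding lex_initial_def lookup_single_times
  by (auto intro: add_left_mono)

lemma nat_pow_type_algebra:
  "x [^]\<^bsub>ring_of_type_algebra\<lparr>carrier := C\<rparr>\<^esub> (n :: nat) = x ^ n"
  by (induction n) (simp_all add: nat_pow_def ring_of_type_algebra_def power_commutes)

lemma single_single_power:
  "single (single v 1) 1 ^ n = (single (single v n) 1 :: ('x \<Rightarrow>\<^sub>0 nat) \<Rightarrow>\<^sub>0 'k::comm_semiring_1)"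
  by (induction n) (simp_all add: mult_single flip: single_add)

text \<open>
  The order on \<open>\<Rightarrow>\<^sub>0\<close> is lexicographic with the smallest variable most significant, and all variables
  in \<open>vs\<close> after \<open>v\<close> are larger than \<open>v\<close>; so the factor \<open>v\<close> makes every monomial of the correction
  term \<open>v r\<close> larger than a monomial in the later variables.
\<close>

lemma boundary_lex_initial:
  fixes C :: "(('x::linorder \<Rightarrow>\<^sub>0 nat) \<Rightarrow>\<^sub>0 'k::comm_ring_1) set"
  assumes "sorted_wrt (<) vs"
    and "s \<in> boundary (ring_of_type_algebra\<lparr>carrier := C\<rparr>) (map (\<lambda>v. single (single v 1) 1) vs)"
  shows "\<exists>t. keys t \<subseteq> set vs \<and> lex_initial t s"
  using assms
proof (induction vs arbitrary: s)
  case Nil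
  then show ?case
    by (auto simp: ring_of_type_algebra_def lex_initial_def)
next
  case (Cons v vs)
  let ?R = "ring_of_type_algebra\<lparr>carrier := C\<rparr> :: (('x \<Rightarrow>\<^sub>0 nat) \<Rightarrow>\<^sub>0 'k) ring"
  let ?X = "single (single v 1) 1 :: ('x \<Rightarrow>\<^sub>0 nat) \<Rightarrow>\<^sub>0 'k"
  obtain n :: nat and s' r where s: "s = ?X [^]\<^bsub>?R\<^esub> n \<otimes>\<^bsub>?R\<^esub> (s' \<oplus>\<^bsub>?R\<^esub> ?X \<otimes>\<^bsub>?R\<^esub> r)"
    and s': "s' \<in> boundary ?R (map (\<lambda>v. single (single v 1) 1) vs)"
    using Cons.prems(2) by auto
  define w :: "'x \<Rightarrow>\<^sub>0 nat" where "w = single v n"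
  have s_eq: "s = single w 1 * (s' + ?X * r)"
    unfolding s nat_pow_type_algebra by (simp add: ring_of_type_algebra_def single_single_power w_def del: One_nat_def)
  obtain t where t: "keys t \<subseteq> set vs" "lex_initial t s'"
    using Cons.IH[OF _ s'] Cons.prems(1) by auto
  have gt: "t < u" if u: "u \<in> keys (?X * r)" for u
  proof (rule lex_less[of v])
    show "lookup t v' = 0" if "v' \<le> v" for v'
      using that t(1) Cons.prems(1) by (fastforce simp: in_keys_iff)
    obtain x where "u = single v 1 + x"
      using keys_single_times[OF u] by auto
    then show "lookup u v \<noteq> 0"
      by (simp add: lookup_add)
  qed
  have "lookup (?X * r) t = 0"
    using gt[of t] by (auto simp: in_keys_iff)
  then have "lex_initial t (s' + ?X * r)"
    using t(2) gt keys_add[of s' "?X * r"] by (fastforce simp: lex_initial_def lookup_add)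
  then have "lex_initial (w + t) s"
    unfolding s_eq by (rule lex_initial_times_single)
  moreover have "keys (w + t) \<subseteq> set (v # vs)"
    using t(1) keys_add[of w t] unfolding w_def
    by (auto split: if_splits)
  ultimately show ?case
    by blast
qed

section \<open>Counting exponent vectors\<close>

definition monoms :: "'x set \<Rightarrow> nat \<Rightarrow> ('x \<Rightarrow>\<^sub>0 nat) set"
  where "monoms V d = {t. keys t \<subseteq> V \<and> tdeg t < d}"

lemma inj_on_lookup: "inj_on (\<lambda>t. \<lambda>v\<in>V. lookup t v) {t. keys t \<subseteq> V}"
proof (rule inj_onI, rule poly_mapping_eqI)
  fix s t v
  assume st: "s \<in> {t. keys t \<subseteq> V}" "t \<in> {t. keys t \<subseteq> V}"
    "(\<lambda>v\<in>V. lookup s v) = (\<lambda>v\<in>V. lookup t v)"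
  show "lookup s v = lookup t v"
  proof (cases "v \<in> V")
    case True
    then show ?thesis
      using fun_cong[OF st(3), of v] by simp
  next
    case False
    then have "v \<notin> keys s" "v \<notin> keys t"
      using st by auto
    then show ?thesis
      by (simp add: in_keys_iff)
  qed
qed

lemma card_exponents_le:
  assumes V: "finite V" and T: "\<And>t. t \<in> T \<Longrightarrow> keys t \<subseteq> V" "\<And>t v. t \<in> T \<Longrightarrow> v \<in> V \<Longrightarrow> lookup t v < b v"
  shows "finite T" "card T \<le> (\<Prod>v\<in>V. b v)"
proof -
  have inj: "inj_on (\<lambda>t. \<lambda>v\<in>V. lookup t v) T"
    by (rule inj_on_subset[OF inj_on_lookup]) (use T(1) in auto)
  have sub: "(\<lambda>t. \<lambda>v\<in>V. lookup t v) ` T \<subseteq> PiE V (\<lambda>v. {..<b v})"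
    using T(2) by auto
  have fin: "finite (PiE V (\<lambda>v. {..<b v}))"
    using V by (intro finite_PiE) auto
  show "finite T"
    using finite_imageD[OF finite_subset[OF sub fin] inj] .
  show "card T \<le> (\<Prod>v\<in>V. b v)"
    using card_inj_on_le[OF inj sub fin] V by (simp add: card_PiE)
qed

lemma lookup_le_tdeg: "lookup t v \<le> tdeg t"
proof (cases "v \<in> keys t")
  case True
  then show ?thesis
    unfolding tdeg_def by (intro member_le_sum) auto
qed (simp add: in_keys_iff)

lemma finite_monoms: "finite V \<Longrightarrow> finite (monoms V d)"
  by (rule card_exponents_le(1)[where b = "\<lambda>_. d"])
    (auto simp: monoms_def intro: le_less_trans[OF lookup_le_tdeg])

text \<open>The vectors with all entries below \<open>e\<close> form a cube of
  \<open>e ^ card V\<close> points. Their degree stays below \<open>card V * e\<close>, strictly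
  because \<open>V\<close> is nonempty.\<close>

lemma card_monoms_ge:
  assumes "finite V" "V \<noteq> {}" "0 < e"
  shows "e ^ card V \<le> card (monoms V (card V * e))"
proof -
  define h where "h = (\<lambda>g :: _ \<Rightarrow> nat. \<Sum>v\<in>V. single v (g v))"
  have lookup_h: "lookup (h g) v = (if v \<in> V then g v else 0)" for g v
    using assms(1) by (simp add: h_def lookup_sum lookup_single when_def)
  have keys_h: "keys (h g) \<subseteq> V" for g
    by (auto simp: in_keys_iff lookup_h split: if_splits)
  have "inj_on h (PiE V (\<lambda>_. {..<e}))"
  proof (rule inj_onI)
    fix g g' assume g: "g \<in> PiE V (\<lambda>_. {..<e})" "g' \<in> PiE V (\<lambda>_. {..<e})" "h g = h g'"
    show "g = g'"
    proof (rule PiE_ext[OF g(1,2)])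
      show "g v = g' v" if "v \<in> V" for v
        using arg_cong[OF g(3), of "\<lambda>t. lookup t v"] that by (simp add: lookup_h)
    qed
  qed
  moreover have "h ` PiE V (\<lambda>_. {..<e}) \<subseteq> monoms V (card V * e)"
  proof clarify
    fix g assume g: "g \<in> PiE V (\<lambda>_. {..<e})"
    have "tdeg (h g) = (\<Sum>v\<in>V. g v)"
      using tdeg_superset[OF assms(1) keys_h] by (simp add: lookup_h)
    also have "\<dots> < (\<Sum>v\<in>V. e)"
      using g assms by (intro sum_strict_mono) auto
    finally show "h g \<in> monoms V (card V * e)"
      using keys_h by (simp add: monoms_def)
  qed
  ultimately have "card (PiE V (\<lambda>_. {..<e})) \<le> card (monoms V (card V * e))"
    using finite_monoms[OF assms(1)] by (intro card_inj_on_le)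
  then show ?thesis
    using assms(1) by (simp add: card_PiE)
qed

text \<open>Monomials are sorted by the set \<open>U\<close> of variables whose exponent reaches
  \<open>M\<close>. At most \<open>2 ^ card V\<close> sets occur, and for fixed \<open>U\<close> the
  exponents are below \<open>d\<close> on \<open>U\<close> and below \<open>M\<close>
  elsewhere.\<close>

lemma card_monoms_few_large:
  assumes V: "finite V" and r: "0 < r" and M: "0 < M" and d: "0 < d"
  shows "card {u \<in> monoms V d. card {v\<in>V. M \<le> lookup u v} < r} \<le> 2 ^ card V * (d ^ (r - 1) * M ^ card V)"
proof -
  define P where "P = {U. U \<subseteq> V \<and> card U < r}"
  define E where "E = (\<lambda>U. {u \<in> monoms V d. {v\<in>V. M \<le> lookup u v} = U})"
  have "finite P"
    unfolding P_def using V by simp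
  have "card P \<le> card (Pow V)"
    unfolding P_def using V by (intro card_mono) auto
  then have card_P: "card P \<le> 2 ^ card V"
    using V by (simp add: card_Pow)
  have card_E: "card (E U) \<le> d ^ (r - 1) * M ^ card V" if U: "U \<in> P" for U
  proof -
    have fU: "finite U" "U \<subseteq> V" "card U \<le> r - 1"
      using U V finite_subset by (auto simp: P_def)
    have "card (E U) \<le> (\<Prod>v\<in>V. if v \<in> U then d else M)"
    proof (rule card_exponents_le(2)[OF V])
      show "lookup u v < (if v \<in> U then d else M)" if "u \<in> E U" "v \<in> V" for u v
        using that le_less_trans[OF lookup_le_tdeg[of u v], of d]
        by (auto simp: E_def monoms_def not_le)
    qed (auto simp: E_def monoms_def)
    also have "\<dots> = d ^ card U * M ^ card (V - U)"
      using V fU by (simp add: prod.If_cases Int_absorb1 Diff_eq)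
    also have "\<dots> \<le> d ^ (r - 1) * M ^ card V"
      using fU V M d by (intro mult_mono power_increasing card_mono) auto
    finally show ?thesis .
  qed
  have "{u \<in> monoms V d. card {v\<in>V. M \<le> lookup u v} < r} = (\<Union>U\<in>P. E U)"
    by (auto simp: P_def E_def)
  also have "card \<dots> \<le> (\<Sum>U\<in>P. card (E U))"
    by (rule card_UN_le[OF \<open>finite P\<close>])
  also have "\<dots> \<le> (\<Sum>U\<in>P. d ^ (r - 1) * M ^ card V)"
    by (intro sum_mono card_E)
  also have "\<dots> \<le> 2 ^ card V * (d ^ (r - 1) * M ^ card V)"
    using card_P by (simp add: mult_le_mono1)
  finally show ?thesis .
qed

section \<open>Linear algebra of truncated polynomials\<close>

definition trunc :: "'x set \<Rightarrow> nat \<Rightarrow> (('x \<Rightarrow>\<^sub>0 nat) \<Rightarrow>\<^sub>0 'k::comm_ring_1) \<Rightarrow> ('x \<Rightarrow>\<^sub>0 nat) \<Rightarrow> 'k"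
  where "trunc V d p = (\<lambda>t. if t \<in> monoms V d then lookup p t else 0)"

lemma trunc_add: "trunc V d (p + q) = trunc V d p + trunc V d q"
  by (rule ext) (simp add: trunc_def lookup_add)

lemma trunc_diff: "trunc V d (p - q) = trunc V d p - trunc V d q"
  by (rule ext) (simp add: trunc_def lookup_minus)

lemma trunc_smult: "trunc V d (single 0 c * p) = (\<lambda>t. c * trunc V d p t)"
  using lookup_single_times[of 0 c p] by (auto simp: trunc_def)

lemma trunc_ord_ge:
  assumes "ord_ge d p"
  shows "trunc V d p = 0"
proof (rule ext)
  fix t
  have "lookup p t = 0" if "tdeg t < d"
    using assms that not_in_keys_iff_lookup_eq_zero[of t p] by (force simp: ord_ge_def)
  then show "trunc V d p t = 0 t"
    by (simp add: trunc_def monoms_def)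
qed

lemma trunc_0: "trunc V d 0 = 0"
  by (rule ext) (simp add: trunc_def)

text \<open>Truncations are plain functions into the field, so span and independence are taken in
  the space of all functions with pointwise operations.\<close>

global_interpretation fun_space: vector_space "\<lambda>(c :: 'k::field) (g :: 'i \<Rightarrow> 'k) x. c * g x"
  by unfold_locales (auto simp: fun_eq_iff algebra_simps)

text \<open>The factors from \<open>F\<close> are recorded by exponents \<open>e\<close> instead of
  being multiplied out; the pair \<open>(e, u)\<close> is the state of the rewriting
  process.\<close>

definition word :: "(('x \<Rightarrow>\<^sub>0 nat) \<Rightarrow>\<^sub>0 'k) set \<Rightarrow> ((('x \<Rightarrow>\<^sub>0 nat) \<Rightarrow>\<^sub>0 'k) \<Rightarrow> nat) \<Rightarrow> ('x \<Rightarrow>\<^sub>0 nat) \<Rightarrow>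
    ('x \<Rightarrow>\<^sub>0 nat) \<Rightarrow>\<^sub>0 'k::comm_ring_1"
  where "word F e u = (\<Prod>f\<in>F. f ^ e f) * single u 1"

text \<open>Elements of \<open>F\<close> have no constant term, so every factor raises the order by
  at least one. Words with exponent sum at least \<open>d\<close> thus vanish under truncation,
  which bounds the exponents that matter.\<close>

lemma ord_ge_word:
  fixes F :: "(('x \<Rightarrow>\<^sub>0 nat) \<Rightarrow>\<^sub>0 'k::comm_ring_1) set"
  assumes "finite F" "\<And>f. f \<in> F \<Longrightarrow> lookup f 0 = 0"
  shows "ord_ge ((\<Sum>f\<in>F. e f) + tdeg u) (word F e u)"
proof -
  have one: "ord_ge 1 f" if "f \<in> F" for f
    unfolding ord_ge_def
  proof
    fix t assume "t \<in> keys f"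
    then have "t \<noteq> 0"
      using assms(2)[OF that] by (auto simp: in_keys_iff)
    then show "1 \<le> tdeg t"
      using tdeg_eq_0[of t] by linarith
  qed
  have "ord_ge (\<Sum>f\<in>F. e f * 1) (\<Prod>f\<in>F. f ^ e f)"
    by (intro ord_ge_prod ord_ge_power one assms(1))
  moreover have "ord_ge (tdeg u) (single u 1 :: ('x \<Rightarrow>\<^sub>0 nat) \<Rightarrow>\<^sub>0 'k)"
    by (simp add: ord_ge_def)
  ultimately show ?thesis
    unfolding word_def by (auto intro: ord_ge_mult)
qed

lemma word_times:
  "word F e w * p = (\<Sum>q\<in>keys p. single 0 (lookup p q) * word F e (w + q))"
proof -
  have "word F e w * p = word F e w * (\<Sum>q\<in>keys p. single q (lookup p q))"
    by (simp add: poly_mapping_sum_single)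
  also have "\<dots> = (\<Sum>q\<in>keys p. word F e w * single q (lookup p q))"
    by (rule sum_distrib_left)
  also have "\<dots> = (\<Sum>q\<in>keys p. single 0 (lookup p q) * word F e (w + q))"
  proof (rule sum.cong[OF refl])
    fix q
    have "word F e w * single q (lookup p q) = (\<Prod>f\<in>F. f ^ e f) * (single w 1 * single q (lookup p q))"
      unfolding word_def by (rule mult.assoc)
    also have "single w 1 * single q (lookup p q) = single 0 (lookup p q) * single (w + q) 1"
      by (simp add: mult_single)
    also have "(\<Prod>f\<in>F. f ^ e f) * \<dots> = single 0 (lookup p q) * word F e (w + q)"
      unfolding word_def by (rule mult.left_commute)
    finally show "word F e w * single q (lookup p q) = single 0 (lookup p q) * word F e (w + q)" .
  qed
  finally show ?thesis .
qed

lemma trunc_word_times_in_span: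
  fixes F :: "(('x \<Rightarrow>\<^sub>0 nat) \<Rightarrow>\<^sub>0 'k::field) set"
  assumes "\<And>q. q \<in> keys p \<Longrightarrow> trunc V d (word F e (w + q)) \<in> fun_space.span B"
  shows "trunc V d (word F e w * p) \<in> fun_space.span B"
proof -
  have "trunc V d (\<Sum>q\<in>K. single 0 (lookup p q) * word F e (w + q)) \<in> fun_space.span B"
    if "finite K" "K \<subseteq> keys p" for K
    using that
  proof (induction K rule: finite_induct)
    case empty
    show ?case
      by (simp only: sum.empty trunc_0 fun_space.span_zero)
  next
    case (insert q K)
    then show ?case
      unfolding sum.insert[OF insert.hyps(1,2)] trunc_add trunc_smult
      by (intro fun_space.span_add fun_space.span_scale assms) auto
  qed
  then show ?thesis
    unfolding word_times by simp
qed

text \<open>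
  Modulo terms of degree at least \<open>d\<close>, a monomial divisible by a lexicographically initial monomial
  of an element of the ideal \<open>(F)\<close> is rewritten into lexicographically larger monomials and into
  multiples of elements of \<open>F\<close>; both steps can be repeated only finitely often.
\<close>

lemma trunc_word_in_span:
  fixes F :: "(('x::linorder \<Rightarrow>\<^sub>0 nat) \<Rightarrow>\<^sub>0 'k::field) set"
    and d :: nat
  assumes V: "finite V" and F: "finite F" "\<And>f. f \<in> F \<Longrightarrow> lookup f 0 = 0"
    and T: "\<And>t. t \<in> T \<Longrightarrow> \<exists>g. (\<forall>f\<in>F. g f \<in> polys V) \<and> (\<Sum>f\<in>F. g f * f) \<in> polys V \<and>
      lex_initial t (\<Sum>f\<in>F. g f * f)"
    and u: "keys u \<subseteq> V"
  defines "G \<equiv> (\<lambda>(e, u). word F e u) `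
    (PiE F (\<lambda>_. {..<d}) \<times> {u \<in> monoms V d. \<forall>t\<in>T. \<forall>w. u \<noteq> w + t})"
  shows "trunc V d (word F e u) \<in> fun_space.span (trunc V d ` G)"
  using u
\<comment> \<open>The outer measure is the room left for further factors from \<open>F\<close>
  before truncation kills the word.\<close>
proof (induction "d - (\<Sum>f\<in>F. e f)" arbitrary: e u rule: less_induct)
  case outer: less
  show ?case
    using outer.prems
  \<comment> \<open>For fixed \<open>e\<close>, the inner measure counts the monomials of degree
    below \<open>d\<close> that are still larger than \<open>u\<close>.\<close>
  proof (induction "card {u' \<in> monoms V d. u < u'}" arbitrary: u rule: less_induct)
    case (less u)
    show ?case
    proof (cases "d \<le> (\<Sum>f\<in>F. e f) + tdeg u")
      case True
      then have "ord_ge d (word F e u)"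
        using ord_ge_word[OF F, of e u] by (auto simp: ord_ge_def)
      then have "trunc V d (word F e u) = 0"
        by (rule trunc_ord_ge)
      then show ?thesis
        using fun_space.span_zero by simp
    next
      case False
      then have small: "(\<Sum>f\<in>F. e f) < d" and u: "u \<in> monoms V d"
        using less.prems by (auto simp: monoms_def)
      show ?thesis
      proof (cases "\<forall>t\<in>T. \<forall>w. u \<noteq> w + t")
        case True
        \<comment> \<open>Members of \<open>PiE\<close> are undefined outside \<open>F\<close>, so
          \<open>e\<close> is normalised; a word only reads its values on \<open>F\<close>.\<close>
        define e' where "e' = restrict e F"
        have "e f < d" if "f \<in> F" for f
          using small F(1) that member_le_sum[of f F e] by simp
        then have "e' \<in> PiE F (\<lambda>_. {..<d})"
          by (auto simp: e'_def)
        then have "(e', u) \<in> PiE F (\<lambda>_. {..<d}) \<times> {u \<in> monoms V d. \<forall>t\<in>T. \<forall>w. u \<noteq> w + t}"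
          using True u by simp
        then have "word F e' u \<in> G"
          unfolding G_def by (metis (mono_tags, lifting) image_iff case_prod_conv)
        moreover have "word F e' u = word F e u"
          by (simp add: word_def e'_def)
        ultimately show ?thesis
          by (auto intro: fun_space.span_base)
      next
        case False
        then obtain t w where t: "t \<in> T" and u_eq: "u = w + t"
          by blast
        obtain g where g: "\<forall>f\<in>F. g f \<in> polys V" "(\<Sum>f\<in>F. g f * f) \<in> polys V"
          "lex_initial t (\<Sum>f\<in>F. g f * f)"
          using T[OF t] by blast
        define s where "s = (\<Sum>f\<in>F. g f * f)"
        \<comment> \<open>\<open>q\<close> holds the strictly larger terms of \<open>s\<close>. The
          word at \<open>u = w + t\<close> becomes the word at \<open>w\<close> times
          \<open>s - q\<close>: the part with \<open>q\<close> goes to the inner induction, the part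
          with \<open>s\<close> to the outer one.\<close>
        define q where "q = s - single t 1"
        have w: "keys w \<subseteq> V"
          using less.prems unfolding u_eq by (force simp: in_keys_iff lookup_add)
        have key: "t < t' \<and> keys t' \<subseteq> V" if t': "t' \<in> keys q" for t'
        proof -
          have "t' \<noteq> t" "t' \<in> keys s"
            using t' g(3) unfolding q_def s_def[symmetric]
            by (auto simp: in_keys_iff lex_initial_def lookup_minus lookup_single when_def split: if_splits)
          then show ?thesis
            using g(2,3) unfolding s_def[symmetric] by (auto simp: lex_initial_def polys_def)
        qed
        have "trunc V d (word F e w * q) \<in> fun_space.span (trunc V d ` G)"
        proof (rule trunc_word_times_in_span)
          fix t' assume t': "t' \<in> keys q"
          have lt: "u < w + t'"
            unfolding u_eq using key[OF t'] by (intro add_strict_left_mono) auto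
          have sub: "keys (w + t') \<subseteq> V"
            using w key[OF t'] keys_add[of w t'] by blast
          show "trunc V d (word F e (w + t')) \<in> fun_space.span (trunc V d ` G)"
          proof (cases "w + t' \<in> monoms V d")
            case True
            have "{u' \<in> monoms V d. w + t' < u'} \<subset> {u' \<in> monoms V d. u < u'}"
              using lt True by auto
            then show ?thesis
              using finite_monoms[OF V, of d] by (intro less.hyps sub psubset_card_mono) auto
          next
            case False
            then have "d \<le> (\<Sum>f\<in>F. e f) + tdeg (w + t')"
              using sub by (auto simp: monoms_def)
            then have "ord_ge d (word F e (w + t'))"
              using ord_ge_word[OF F, of e "w + t'"] by (auto simp: ord_ge_def)
            then have "trunc V d (word F e (w + t')) = 0"
              by (rule trunc_ord_ge)
            then show ?thesis
              using fun_space.span_zero by simp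
          qed
        qed
        moreover have "trunc V d (word F e w * s) \<in> fun_space.span (trunc V d ` G)"
        proof -
          have part: "trunc V d (word F e w * (g f * f)) \<in> fun_space.span (trunc V d ` G)"
            if f: "f \<in> F" for f
          proof -
            \<comment> \<open>The factor \<open>f\<close> is absorbed into the exponents and lowers
              the outer measure; the cofactor \<open>g f\<close> is then expanded into
              monomials.\<close>
            define e' where "e' = e(f := Suc (e f))"
            have "word F e w * f = word F e' w"
            proof -
              have "(\<Prod>h\<in>F. h ^ e' h) = f * (\<Prod>h\<in>F. h ^ e h)"
                unfolding prod.remove[OF F(1) f] by (simp add: e'_def mult.assoc)
              then show ?thesis
                by (simp add: word_def ac_simps)
            qed
            then have eq: "word F e w * (g f * f) = word F e' w * g f"
              by (simp only: mult.commute[of "g f"] mult.assoc[symmetric])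
            have Suc: "(\<Sum>h\<in>F. e' h) = Suc (\<Sum>h\<in>F. e h)"
              unfolding sum.remove[OF F(1) f] by (simp add: e'_def)
            have "trunc V d (word F e' (w + x)) \<in> fun_space.span (trunc V d ` G)"
              if "x \<in> keys (g f)" for x
            proof (rule outer.hyps)
              show "keys (w + x) \<subseteq> V"
                using g(1) f that w keys_add[of w x] by (fastforce simp: polys_def)
            qed (use small Suc in linarith)
            then show ?thesis
              unfolding eq by (rule trunc_word_times_in_span)
          qed
          have "trunc V d (\<Sum>f\<in>F'. word F e w * (g f * f)) \<in> fun_space.span (trunc V d ` G)"
            if "F' \<subseteq> F" for F'
            using finite_subset[OF that F(1)] that
          proof (induction F' rule: finite_induct)
            case empty
            show ?case
              by (simp only: sum.empty trunc_0 fun_space.span_zero)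
          next
            case (insert f F')
            then show ?case
              unfolding sum.insert[OF insert.hyps(1,2)] trunc_add
              by (intro fun_space.span_add part) auto
          qed
          then show ?thesis
            unfolding s_def sum_distrib_left by blast
        qed
        ultimately have "trunc V d (word F e w * s - word F e w * q) \<in> fun_space.span (trunc V d ` G)"
          unfolding trunc_diff by (intro fun_space.span_diff)
        moreover have "word F e w * s - word F e w * q = word F e u"
        proof -
          have "word F e w * s - word F e w * q = word F e w * single t 1"
            by (simp add: q_def algebra_simps)
          also have "\<dots> = word F e u"
            by (simp add: word_def u_eq mult_single mult.assoc)
          finally show ?thesis .
        qed
        ultimately show ?thesis
          by simp
      qed
    qed
  qed
qed

text \<open>The monomials of degree below \<open>d\<close> have linearly independent truncations,
  and as words without factors from \<open>F\<close> they lie in the span of the irreducible words.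
  Hence they are at most as many as the pairs of an exponent family below \<open>d\<close> and an
  irreducible monomial.\<close>

lemma card_monoms_le:
  fixes F :: "(('x::linorder \<Rightarrow>\<^sub>0 nat) \<Rightarrow>\<^sub>0 'k::field) set"
  assumes V: "finite V" and F: "finite F" "\<And>f. f \<in> F \<Longrightarrow> lookup f 0 = 0"
    and T: "\<And>t. t \<in> T \<Longrightarrow> \<exists>g. (\<forall>f\<in>F. g f \<in> polys V) \<and> (\<Sum>f\<in>F. g f * f) \<in> polys V \<and>
      lex_initial t (\<Sum>f\<in>F. g f * f)"
  shows "card (monoms V d) \<le> d ^ card F * card {u \<in> monoms V d. \<forall>t\<in>T. \<forall>w. u \<noteq> w + t}"
proof -
  define N where "N = PiE F (\<lambda>_. {..<d}) \<times> {u \<in> monoms V d. \<forall>t\<in>T. \<forall>w. u \<noteq> w + t}"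
  define G where "G = (\<lambda>(e, u). word F e u) ` N"
  have fN: "finite N"
    unfolding N_def using F(1) finite_monoms[OF V] by (intro finite_cartesian_product finite_PiE) auto
  define \<delta> where "\<delta> = (\<lambda>u t :: 'x \<Rightarrow>\<^sub>0 nat. if t = u then 1 else 0 :: 'k)"
  have \<delta>: "trunc V d (word F (\<lambda>_. 0) u) = \<delta> u" if "u \<in> monoms V d" for u
    using that by (auto simp: trunc_def word_def \<delta>_def lookup_single when_def)
  have inj: "inj_on \<delta> (monoms V d)"
  proof (rule inj_onI)
    fix u v assume "\<delta> u = \<delta> v"
    then have "\<delta> u u = \<delta> v u"
      by (rule fun_cong)
    then show "u = v"
      by (simp add: \<delta>_def split: if_splits)
  qed
  have "fun_space.independent (\<delta> ` monoms V d)"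
  proof (rule fun_space.independent_if_scalars_zero)
    show "finite (\<delta> ` monoms V d)"
      using finite_monoms[OF V] by blast
    fix c and x :: "('x \<Rightarrow>\<^sub>0 nat) \<Rightarrow> 'k"
    assume c: "(\<Sum>x\<in>\<delta> ` monoms V d. (\<lambda>t. c x * x t)) = 0" and x: "x \<in> \<delta> ` monoms V d"
    obtain u where u: "u \<in> monoms V d" "x = \<delta> u"
      using x by blast
    have "0 = (\<Sum>x\<in>\<delta> ` monoms V d. (\<lambda>t. c x * x t)) u"
      unfolding c by simp
    also have "\<dots> = (\<Sum>x\<in>\<delta> ` monoms V d. c x * x u)"
    proof -
      have "(\<Sum>x\<in>K. (\<lambda>t. c x * x t)) u = (\<Sum>x\<in>K. c x * x u)" for K
        by (induction K rule: infinite_finite_induct) auto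
      then show ?thesis .
    qed
    also have "\<dots> = (\<Sum>v\<in>monoms V d. c (\<delta> v) * \<delta> v u)"
      by (simp add: sum.reindex[OF inj])
    also have "\<dots> = (\<Sum>v\<in>monoms V d. if v = u then c (\<delta> u) else 0)"
      by (rule sum.cong[OF refl]) (simp add: \<delta>_def)
    also have "\<dots> = c (\<delta> u)"
      using u finite_monoms[OF V] by simp
    finally show "c x = 0"
      using u by simp
  qed
  moreover have "\<delta> ` monoms V d \<subseteq> fun_space.span (trunc V d ` G)"
  proof clarify
    fix u assume u: "u \<in> monoms V d"
    show "\<delta> u \<in> fun_space.span (trunc V d ` G)"
      unfolding \<delta>[OF u, symmetric] G_def N_def
      by (rule trunc_word_in_span[OF V F T]) (use u in \<open>auto simp: monoms_def\<close>)
  qed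
  ultimately have "card (\<delta> ` monoms V d) \<le> card (trunc V d ` G)"
    by (intro conjunct2[OF fun_space.independent_span_bound] finite_imageI)
      (auto simp: G_def intro: fN)
  also have "\<dots> \<le> card N"
    unfolding G_def by (rule order.trans[OF card_image_le[OF finite_imageI[OF fN]] card_image_le[OF fN]])
  also have "\<dots> = d ^ card F * card {u \<in> monoms V d. \<forall>t\<in>T. \<forall>w. u \<noteq> w + t}"
    using F(1) by (simp add: N_def card_cartesian_product card_PiE)
  finally show ?thesis
    by (simp add: card_image[OF inj])
qed

text \<open>
  Otherwise the number of monomials of degree less than \<open>d\<close> in \<open>n\<close> variables would be
  \<open>O(d\<^bsup>card F + r - 1\<^esup>)\<close>.
\<close>

lemma exists_independent_vars:
  fixes F :: "(('x::linorder \<Rightarrow>\<^sub>0 nat) \<Rightarrow>\<^sub>0 'k::field) set"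
  assumes V: "finite V" and F: "finite F" "\<And>f. f \<in> F \<Longrightarrow> lookup f 0 = 0"
    and r: "r \<le> card V - card F"
  shows "\<exists>U\<subseteq>V. card U = r \<and> (\<forall>t g. keys t \<subseteq> U \<longrightarrow> (\<forall>f\<in>F. g f \<in> polys V) \<longrightarrow>
    (\<Sum>f\<in>F. g f * f) \<in> polys V \<longrightarrow> \<not> lex_initial t (\<Sum>f\<in>F. g f * f))"
\<comment> \<open>The counting below works with the exponent \<open>r - 1\<close>. For
  \<open>r = 0\<close> only the monomial 1 is supported on the empty set, and a combination of
  elements of \<open>F\<close> has no constant term.\<close>
proof (cases "r = 0")
  case True
  have "\<not> lex_initial t (\<Sum>f\<in>F. g f * f)" if "keys t \<subseteq> {}" for t g
  proof -
    have "t = 0"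
      using that by (intro poly_mapping_eqI) (auto simp: in_keys_iff)
    have "ord_ge 1 (g f * f)" if "f \<in> F" for f
    proof -
      have "1 \<le> tdeg u" if "u \<in> keys f" for u
        using F(2)[OF \<open>f \<in> F\<close>] that tdeg_eq_0[of u] by (cases "tdeg u") (auto simp: in_keys_iff)
      then show ?thesis
        using ord_ge_mult[of 0 "g f" 1 f] by (simp add: ord_ge_def)
    qed
    then have "0 \<notin> keys (g f * f)" if "f \<in> F" for f
      using that unfolding ord_ge_def tdeg_def
      by (metis keys_zero not_one_le_zero sum.empty)
    then have "lookup (g f * f) 0 = 0" if "f \<in> F" for f
      using that by (simp add: in_keys_iff)
    then show ?thesis
      using \<open>t = 0\<close> by (simp add: lex_initial_def lookup_sum)
  qed
  then show ?thesis
    using True by (intro exI[of _ "{}"]) simp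
next
  case False
  show ?thesis
  proof (rule ccontr)
    assume contra: "\<not> ?thesis"
    define Us where "Us = {U. U \<subseteq> V \<and> card U = r}"
    have fin: "finite Us"
      unfolding Us_def using V by simp
    have "\<forall>U\<in>Us. \<exists>t. keys t \<subseteq> U \<and> (\<exists>g. (\<forall>f\<in>F. g f \<in> polys V) \<and> (\<Sum>f\<in>F. g f * f) \<in> polys V \<and>
      lex_initial t (\<Sum>f\<in>F. g f * f))"
      using contra unfolding Us_def by blast
    from bchoice[OF this] obtain t where t: "\<And>U. U \<in> Us \<Longrightarrow> keys (t U) \<subseteq> U"
      "\<And>U. U \<in> Us \<Longrightarrow> \<exists>g. (\<forall>f\<in>F. g f \<in> polys V) \<and> (\<Sum>f\<in>F. g f * f) \<in> polys V \<and>
        lex_initial (t U) (\<Sum>f\<in>F. g f * f)"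
      by blast
    \<comment> \<open>\<open>M\<close> exceeds every exponent of the chosen initial monomials, so
      any monomial whose exponents reach \<open>M\<close> on a set \<open>U\<close> is divisible by
      \<open>t U\<close>.\<close>
    define M where "M = Suc (\<Sum>U\<in>Us. tdeg (t U))"
    have M: "lookup (t U) v < M" if "U \<in> Us" for U v
      using lookup_le_tdeg[of "t U" v] member_le_sum[OF that _ fin, of "\<lambda>U. tdeg (t U)"]
      by (simp add: M_def)
    define n where "n = card V"
    have n: "0 < n" "card F + (r - 1) \<le> n - 1"
      using False r by (auto simp: n_def)
    \<comment> \<open>\<open>C\<close> collects the factors independent of \<open>e\<close> once
      \<open>d = n * e\<close> is substituted. With \<open>e = Suc C\<close> the upper bound
      \<open>C * e ^ (n - 1)\<close> stays below the lower bound \<open>e ^ n\<close>.\<close>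
    define C where "C = 2 ^ n * M ^ n * n ^ (n - 1)"
    define e where "e = Suc C"
    define d where "d = n * e"
    have d: "0 < d"
      using n by (simp add: d_def e_def)
    have "e ^ n \<le> card (monoms V d)"
      unfolding d_def n_def by (rule card_monoms_ge) (use V n in \<open>auto simp: n_def e_def\<close>)
    also have "\<dots> \<le> d ^ card F * card {u \<in> monoms V d. \<forall>s\<in>t ` Us. \<forall>w. u \<noteq> w + s}"
      by (rule card_monoms_le[OF V F]) (use t(2) in auto)
    also have "\<dots> \<le> d ^ card F * card {u \<in> monoms V d. card {v\<in>V. M \<le> lookup u v} < r}"
    proof (intro mult_le_mono card_mono)
      show "finite {u \<in> monoms V d. card {v\<in>V. M \<le> lookup u v} < r}"
        using finite_monoms[OF V] by simp
      have "\<exists>s\<in>t ` Us. \<exists>w. u = w + s" if large: "\<not> card {v\<in>V. M \<le> lookup u v} < r" for u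
      proof -
        obtain U where U: "U \<subseteq> {v\<in>V. M \<le> lookup u v}" "card U = r"
          by (rule obtain_subset_with_card_n[OF large[unfolded not_less]])
        then have "U \<in> Us"
          by (auto simp: Us_def)
        have "lookup (t U) v \<le> lookup u v" for v
        proof (cases "v \<in> U")
          case True
          then show ?thesis
            using U(1) M[OF \<open>U \<in> Us\<close>, of v] by auto
        next
          case False
          then have "v \<notin> keys (t U)"
            using t(1)[OF \<open>U \<in> Us\<close>] by blast
          then show ?thesis
            by (simp add: in_keys_iff)
        qed
        then have "u = (u - t U) + t U"
          by (intro poly_mapping_eqI) (simp add: lookup_add lookup_minus)
        then show ?thesis
          using \<open>U \<in> Us\<close> by blast
      qed
      then show "{u \<in> monoms V d. \<forall>s\<in>t ` Us. \<forall>w. u \<noteq> w + s} \<subseteq>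
          {u \<in> monoms V d. card {v\<in>V. M \<le> lookup u v} < r}"
        by blast
    qed simp
    also have "\<dots> \<le> d ^ card F * (2 ^ n * (d ^ (r - 1) * M ^ n))"
      unfolding n_def using False d
      by (intro mult_le_mono order_refl card_monoms_few_large V) (auto simp: M_def)
    also have "\<dots> = 2 ^ n * M ^ n * d ^ (card F + (r - 1))"
      by (simp add: power_add ac_simps)
    also have "\<dots> \<le> 2 ^ n * M ^ n * d ^ (n - 1)"
      using n d by (intro mult_le_mono order_refl power_increasing) auto
    also have "\<dots> = C * e ^ (n - 1)"
      by (simp add: C_def d_def power_mult_distrib)
    also have "\<dots> < e * e ^ (n - 1)"
      by (simp add: e_def)
    also have "\<dots> = e ^ n"
      using n by (simp add: power_eq_if)
    finally show False
      by simp
  qed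
qed

section \<open>Polynomial rings and their quotients\<close>

lemma polys_0: "0 \<in> polys V" and polys_1: "1 \<in> polys V"
  by (auto simp: polys_def)

lemma polys_single: "keys t \<subseteq> V \<Longrightarrow> single t c \<in> polys V"
  by (auto simp: polys_def)

lemma polys_Const: "Const c \<in> polys V"
  by (simp add: Const_def polys_single)

lemma polys_Var: "v \<in> V \<Longrightarrow> Var v \<in> polys V"
  by (simp add: Var_def polys_single)

lemma polys_add: "p \<in> polys V \<Longrightarrow> q \<in> polys V \<Longrightarrow> p + q \<in> polys V"
  using keys_add[of p q] by (auto simp: polys_def)

lemma polys_uminus: "p \<in> polys V \<Longrightarrow> - p \<in> polys V"
  by (auto simp: polys_def in_keys_iff)

lemma polys_diff: "p \<in> polys V \<Longrightarrow> q \<in> polys V \<Longrightarrow> p - q \<in> polys V"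
  using polys_add[OF _ polys_uminus, of p V q] by simp

lemma polys_mult:
  assumes "p \<in> polys V" "q \<in> polys V"
  shows "p * q \<in> polys V"
  unfolding polys_def
proof (intro CollectI ballI)
  fix u assume "u \<in> keys (p * q)"
  then obtain s t where st: "u = s + t" "s \<in> keys p" "t \<in> keys q"
    using keys_mult[of p q] by auto
  then have "keys s \<subseteq> V" "keys t \<subseteq> V"
    using assms unfolding polys_def by blast+
  then show "keys u \<subseteq> V"
    unfolding st(1) using keys_add[of s t] by blast
qed

lemma polys_sum: "(\<And>i. i \<in> I \<Longrightarrow> p i \<in> polys V) \<Longrightarrow> (\<Sum>i\<in>I. p i) \<in> polys V"
  by (induction I rule: infinite_finite_induct) (auto simp: polys_0 polys_add)

lemma polys_prod: "(\<And>i. i \<in> I \<Longrightarrow> p i \<in> polys V) \<Longrightarrow> (\<Prod>i\<in>I. p i) \<in> polys V"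
  by (induction I rule: infinite_finite_induct) (auto simp: polys_1 polys_mult)

lemma polys_power: "p \<in> polys V \<Longrightarrow> p ^ n \<in> polys V"
  by (induction n) (auto simp: polys_1 polys_mult)

abbreviation mpoly_ring :: "'x set \<Rightarrow> (('x \<Rightarrow>\<^sub>0 nat) \<Rightarrow>\<^sub>0 'k::comm_ring_1) ring"
  where "mpoly_ring V \<equiv> ring_of_type_algebra\<lparr>carrier := polys V\<rparr>"

lemma P_ring_eq: "P_ring m \<Gamma> = mpoly_ring (vars m \<Gamma>)"
  by (simp add: P_ring_def polys_def)

lemma type_algebra_simps [simp]:
  "carrier ring_of_type_algebra = UNIV"
  "x \<otimes>\<^bsub>ring_of_type_algebra\<^esub> y = x * y" "x \<oplus>\<^bsub>ring_of_type_algebra\<^esub> y = x + y"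
  "\<one>\<^bsub>ring_of_type_algebra\<^esub> = 1" "\<zero>\<^bsub>ring_of_type_algebra\<^esub> = 0"
  "x \<otimes>\<^bsub>ring_of_type_algebra\<lparr>carrier := C\<rparr>\<^esub> y = x * y"
  "x \<oplus>\<^bsub>ring_of_type_algebra\<lparr>carrier := C\<rparr>\<^esub> y = x + y"
  "\<one>\<^bsub>ring_of_type_algebra\<lparr>carrier := C\<rparr>\<^esub> = 1" "\<zero>\<^bsub>ring_of_type_algebra\<lparr>carrier := C\<rparr>\<^esub> = 0"
  by (simp_all add: ring_of_type_algebra_def)

lemma cring_type_algebra: "cring (ring_of_type_algebra :: 'a::comm_ring_1 ring)"
  by (rule cring_from_type_algebra)

lemma type_algebra_a_inv: "\<ominus>\<^bsub>ring_of_type_algebra\<^esub> x = (- x :: 'a::comm_ring_1)"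
proof -
  interpret cring "ring_of_type_algebra :: 'a ring"
    by (rule cring_type_algebra)
  show ?thesis
    using minus_equality[of "- x" x] by simp
qed

lemma cring_poly_ring: "cring (mpoly_ring V :: (('x \<Rightarrow>\<^sub>0 nat) \<Rightarrow>\<^sub>0 'k::comm_ring_1) ring)"
proof -
  interpret cring "ring_of_type_algebra :: (('x \<Rightarrow>\<^sub>0 nat) \<Rightarrow>\<^sub>0 'k) ring"
    by (rule cring_type_algebra)
  have "subring (polys V) (ring_of_type_algebra :: (('x \<Rightarrow>\<^sub>0 nat) \<Rightarrow>\<^sub>0 'k) ring)"
    by (rule subringI) (auto simp: polys_1 polys_mult polys_add polys_uminus type_algebra_a_inv)
  then show ?thesis
    using subcringI' subcring_iff[of "polys V"] by simp
qed

text \<open>The combinations with coefficients in \<open>polys V\<close> form an ideal containing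
  \<open>F\<close>, and the generated ideal is the smallest one.\<close>

lemma genideal_subset_sums:
  fixes F :: "(('x \<Rightarrow>\<^sub>0 nat) \<Rightarrow>\<^sub>0 'k::comm_ring_1) set"
  assumes F: "finite F" "F \<subseteq> polys V"
  shows "genideal (mpoly_ring V) F \<subseteq> {\<Sum>f\<in>F. g f * f |g. \<forall>f\<in>F. g f \<in> polys V}"
proof -
  interpret cring "mpoly_ring V :: (('x \<Rightarrow>\<^sub>0 nat) \<Rightarrow>\<^sub>0 'k) ring"
    by (rule cring_poly_ring)
  let ?P = "mpoly_ring V :: (('x \<Rightarrow>\<^sub>0 nat) \<Rightarrow>\<^sub>0 'k) ring"
  let ?I = "{\<Sum>f\<in>F. g f * f |g. \<forall>f\<in>F. g f \<in> polys V}"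
  have closed: "x * a \<in> ?I" if a: "a \<in> ?I" and x: "x \<in> polys V" for a x
  proof -
    obtain g where g: "a = (\<Sum>f\<in>F. g f * f)" "\<forall>f\<in>F. g f \<in> polys V"
      using a by blast
    then have "x * a = (\<Sum>f\<in>F. (x * g f) * f)" "\<forall>f\<in>F. x * g f \<in> polys V"
      using x by (auto simp: sum_distrib_left mult.assoc polys_mult)
    then show ?thesis
      by (intro CollectI exI[of _ "\<lambda>f. x * g f"] conjI)
  qed
  have "ideal ?I ?P"
  proof (rule idealI)
    show "ring ?P"
      by (rule ring_axioms)
    show "subgroup ?I (add_monoid ?P)"
    proof (rule add.subgroupI)
      show "?I \<subseteq> carrier ?P"
        using F(2) by (auto intro!: polys_sum polys_mult)
      have "\<exists>g. \<forall>f\<in>F. g f \<in> polys V"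
        using polys_0 by (intro exI[of _ "\<lambda>_. 0"]) blast
      then show "?I \<noteq> {}"
        by blast
      show "\<ominus>\<^bsub>?P\<^esub> x \<in> ?I" if x: "x \<in> ?I" for x
      proof -
        have "x \<in> polys V"
          using x F(2) by (auto intro!: polys_sum polys_mult)
        then have "\<ominus>\<^bsub>?P\<^esub> x = (- 1) * x"
          using minus_equality[of "- x" x] polys_uminus[of x V] by simp
        then show ?thesis
          using closed[OF x, of "- 1"] polys_uminus[OF polys_1, of V] by simp
      qed
      show "x \<oplus>\<^bsub>?P\<^esub> y \<in> ?I" if xy: "x \<in> ?I" "y \<in> ?I" for x y
      proof -
        obtain g g' where g: "x = (\<Sum>f\<in>F. g f * f)" "\<forall>f\<in>F. g f \<in> polys V"
          "y = (\<Sum>f\<in>F. g' f * f)" "\<forall>f\<in>F. g' f \<in> polys V"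
          using xy by blast
        then have "x + y = (\<Sum>f\<in>F. (g f + g' f) * f)" "\<forall>f\<in>F. g f + g' f \<in> polys V"
          by (auto simp: sum.distrib distrib_right polys_add)
        then show ?thesis
          unfolding type_algebra_simps by (intro CollectI exI[of _ "\<lambda>f. g f + g' f"] conjI)
      qed
    qed
  qed (use closed in \<open>auto simp: mult.commute\<close>)
  moreover have "F \<subseteq> ?I"
  proof
    fix f assume f: "f \<in> F"
    have "(\<Sum>h\<in>F. (if h = f then 1 else 0) * h) = (\<Sum>h\<in>F. if h = f then f else 0)"
      by (rule sum.cong) auto
    then have "f = (\<Sum>h\<in>F. (if h = f then 1 else 0) * h)"
      using F(1) f by simp
    moreover have "\<forall>h\<in>F. (if h = f then 1 else 0) \<in> polys V"
      by (simp add: polys_0 polys_1)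
    ultimately show "f \<in> ?I"
      by (intro CollectI exI[of _ "\<lambda>h. if h = f then 1 else 0"] conjI)
  qed
  ultimately show ?thesis
    by (rule genideal_minimal)
qed

text \<open>The classes of the variables in an independent set \<open>U\<close> form the sequence
  \<open>ys\<close>. A zero in its boundary would lift to an element of the ideal whose initial
  monomial is supported on \<open>U\<close>, which the choice of \<open>U\<close> excludes.\<close>

theorem krull_dim_poly_ring_Quot:
  fixes F :: "(('x::linorder \<Rightarrow>\<^sub>0 nat) \<Rightarrow>\<^sub>0 'k::field) set"
  assumes V: "finite V" and F: "finite F" "F \<subseteq> polys V" "\<And>f. f \<in> F \<Longrightarrow> lookup f 0 = 0"
  shows "ereal (real (card V) - real (card F)) \<le> krull_dim (mpoly_ring V Quot genideal (mpoly_ring V) F)"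
proof -
  let ?P = "mpoly_ring V :: (('x \<Rightarrow>\<^sub>0 nat) \<Rightarrow>\<^sub>0 'k) ring"
  define I where "I = genideal ?P F"
  interpret P: cring ?P
    by (rule cring_poly_ring)
  interpret I: ideal I ?P
    unfolding I_def by (rule P.genideal_ideal) (use F(2) in simp)
  interpret Q: cring "?P Quot I"
    by (rule I.quotient_is_cring[OF P.is_cring])
  define r where "r = card V - card F"
  obtain U where U: "U \<subseteq> V" "card U = r"
    and indep: "\<And>t g. keys t \<subseteq> U \<Longrightarrow> \<forall>f\<in>F. g f \<in> polys V \<Longrightarrow> (\<Sum>f\<in>F. g f * f) \<in> polys V \<Longrightarrow>
      \<not> lex_initial t (\<Sum>f\<in>F. g f * f)"
    using exists_independent_vars[OF V F(1,3) order_refl] unfolding r_def by blast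
  \<comment> \<open>The variables are listed in increasing order, as
    \<open>boundary_lex_initial\<close> requires.\<close>
  define vs where "vs = sorted_list_of_set U"
  have fU: "finite U"
    using U(1) V by (rule finite_subset)
  have vs: "set vs = U" "sorted_wrt (<) vs" "length vs = r"
    using fU U(2) by (auto simp: vs_def)
  define xs where "xs = map (\<lambda>v. single (single v 1) 1 :: ('x \<Rightarrow>\<^sub>0 nat) \<Rightarrow>\<^sub>0 'k) vs"
  define ys where "ys = map (\<lambda>p. I +>\<^bsub>?P\<^esub> p) xs"
  have xs: "set xs \<subseteq> carrier ?P"
    using U(1) vs(1) by (auto simp: xs_def intro!: polys_single)
  have hom: "(\<lambda>p. I +>\<^bsub>?P\<^esub> p) \<in> ring_hom ?P (?P Quot I)"
    by (rule I.rcos_ring_hom)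
  have surj: "(\<lambda>p. I +>\<^bsub>?P\<^esub> p) ` carrier ?P = carrier (?P Quot I)"
    unfolding FactRing_simps by auto
  have ys: "set ys \<subseteq> carrier (?P Quot I)"
    using xs unfolding ys_def by (auto simp: ring_hom_closed[OF hom])
  have "{\<zero>\<^bsub>?P Quot I\<^esub>} \<inter> boundary (?P Quot I) ys = {}"
  proof (rule ccontr)
    assume "{\<zero>\<^bsub>?P Quot I\<^esub>} \<inter> boundary (?P Quot I) ys \<noteq> {}"
    then have "\<zero>\<^bsub>?P Quot I\<^esub> \<in> boundary (?P Quot I) ys"
      by simp
    then obtain s where s: "s \<in> boundary ?P xs" "s \<in> carrier ?P" "I +>\<^bsub>?P\<^esub> s = \<zero>\<^bsub>?P Quot I\<^esub>"
      using boundary_hom[OF hom surj P.ring_axioms Q.ring_axioms xs] unfolding ys_def by blast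
    have "s \<in> I"
      using I.rcos_const_imp_mem[OF s(2)] s(3) by (simp add: FactRing_def)
    then obtain g where g: "s = (\<Sum>f\<in>F. g f * f)" "\<forall>f\<in>F. g f \<in> polys V"
      using genideal_subset_sums[OF F(1,2)] unfolding I_def by blast
    obtain t where "keys t \<subseteq> set vs" "lex_initial t s"
      using boundary_lex_initial[OF vs(2)] s(1) unfolding xs_def by blast
    then show False
      using indep[of t g] g s(2) vs(1) by simp
  qed
  then obtain p where p: "\<forall>i\<le>length ys. primeideal (p i) (?P Quot I)" "\<forall>i<length ys. p i \<subset> p (Suc i)"
    using Q.prime_chain[OF ys Q.zeroideal] by blast
  have "length ys = r"
    by (simp add: ys_def xs_def vs(3))
  then have "ereal (real r) \<le> krull_dim (?P Quot I)"
    unfolding krull_dim_def using p by (intro SUP_upper) auto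
  \<comment> \<open>\<open>r\<close> is a truncated difference, hence at least the real one. If
    \<open>F\<close> outnumbers \<open>V\<close>, the chain is a single prime ideal.\<close>
  moreover have "ereal (real (card V) - real (card F)) \<le> ereal (real r)"
    by (simp add: r_def)
  ultimately show ?thesis
    unfolding I_def by (rule order.trans[rotated])
qed

section \<open>Homomorphisms to a ring and solutions of the relations\<close>

definition eval_monom :: "('x \<Rightarrow> 'r) \<Rightarrow> ('x \<Rightarrow>\<^sub>0 nat) \<Rightarrow> 'r::comm_ring_1"
  where "eval_monom l t = (\<Prod>v\<in>keys t. l v ^ lookup t v)"

definition eval_hom :: "('k \<Rightarrow> 'r) \<Rightarrow> ('x \<Rightarrow> 'r) \<Rightarrow> (('x \<Rightarrow>\<^sub>0 nat) \<Rightarrow>\<^sub>0 'k::comm_ring_1) \<Rightarrow> 'r::comm_ring_1"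
  where "eval_hom \<phi> l p = (\<Sum>t\<in>keys p. \<phi> (lookup p t) * eval_monom l t)"

lemma evalm_eq_eval_hom: "evalm l p = eval_hom (\<lambda>c. c) l p"
  by (simp add: evalm_def eval_hom_def eval_monom_def)

lemma eval_monom_superset:
  assumes "finite V" "keys t \<subseteq> V"
  shows "eval_monom l t = (\<Prod>v\<in>V. l v ^ lookup t v)"
  unfolding eval_monom_def by (rule prod.mono_neutral_left) (use assms in \<open>auto simp: in_keys_iff\<close>)

lemma eval_monom_add: "eval_monom l (s + t) = eval_monom l s * eval_monom l t"
proof -
  have "finite (keys s \<union> keys t)"
    by simp
  note * = eval_monom_superset[OF this]
  show ?thesis
    using keys_add[of s t] by (simp add: * lookup_add power_add prod.distrib)
qed

lemma eval_hom_cong: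
  assumes "p \<in> polys V" "\<And>v. v \<in> V \<Longrightarrow> l v = l' v"
  shows "eval_hom \<phi> l p = eval_hom \<phi> l' p"
proof -
  have "eval_monom l t = eval_monom l' t" if "t \<in> keys p" for t
  proof -
    have "keys t \<subseteq> V"
      using assms(1) that by (simp add: polys_def)
    then show ?thesis
      unfolding eval_monom_def using assms(2) by (intro prod.cong refl) (metis subsetD)
  qed
  then show ?thesis
    unfolding eval_hom_def by (intro sum.cong refl) simp
qed

text \<open>Turns the absence of a constant term into vanishing at the origin, where the relations
  are easy to evaluate.\<close>

lemma eval_hom_zero:
  fixes p :: "('x \<Rightarrow>\<^sub>0 nat) \<Rightarrow>\<^sub>0 'k::comm_ring_1"
  shows "eval_hom (\<lambda>c. c) (\<lambda>_. 0) p = lookup p 0"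
proof -
  have "eval_monom (\<lambda>_. 0 :: 'k) t = (if t = 0 then 1 else 0)" for t :: "'x \<Rightarrow>\<^sub>0 nat"
  proof (cases "t = 0")
    case False
    then obtain v where "v \<in> keys t"
      by (metis not_in_keys_iff_lookup_eq_zero lookup_zero poly_mapping_eqI)
    then have "(\<Prod>v\<in>keys t. 0 ^ lookup t v) = (0 :: 'k)"
      by (intro prod_zero) (auto simp: in_keys_iff power_0_left intro!: bexI[of _ v])
    then show ?thesis
      using False by (simp add: eval_monom_def)
  qed (simp add: eval_monom_def)
  then have "eval_hom (\<lambda>c. c) (\<lambda>_. 0) p = (\<Sum>t\<in>keys p. if t = 0 then lookup p 0 else 0)"
    unfolding eval_hom_def by (intro sum.cong refl) simp
  then show ?thesis
    by (auto simp: in_keys_iff)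
qed

locale coeff_hom =
  fixes \<phi> :: "'k::comm_ring_1 \<Rightarrow> 'r::comm_ring_1"
  assumes hom: "\<phi> \<in> ring_hom ring_of_type_algebra ring_of_type_algebra"
begin

lemma \<phi>_add: "\<phi> (x + y) = \<phi> x + \<phi> y" and \<phi>_mult: "\<phi> (x * y) = \<phi> x * \<phi> y" and \<phi>_1: "\<phi> 1 = 1"
  using ring_hom_add[OF hom, of x y] ring_hom_mult[OF hom, of x y] ring_hom_one[OF hom] by simp_all

lemma \<phi>_0: "\<phi> 0 = 0"
  using \<phi>_add[of 0 0] by simp

lemma eval_hom_superset:
  assumes "finite T" "keys p \<subseteq> T"
  shows "eval_hom \<phi> l p = (\<Sum>t\<in>T. \<phi> (lookup p t) * eval_monom l t)"
  unfolding eval_hom_def by (rule sum.mono_neutral_left) (use assms in \<open>auto simp: in_keys_iff \<phi>_0\<close>)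

lemma eval_hom_add: "eval_hom \<phi> l (p + q) = eval_hom \<phi> l p + eval_hom \<phi> l q"
proof -
  have "finite (keys p \<union> keys q)"
    by simp
  note * = eval_hom_superset[OF this]
  show ?thesis
    using keys_add[of p q] by (simp add: * lookup_add \<phi>_add distrib_right sum.distrib)
qed

lemma eval_hom_0: "eval_hom \<phi> l 0 = 0"
  by (simp add: eval_hom_def)

lemma eval_hom_uminus: "eval_hom \<phi> l (- p) = - eval_hom \<phi> l p"
  using eval_hom_add[of l p "- p"] by (simp add: eval_hom_0 eq_neg_iff_add_eq_0 add.commute)

lemma eval_hom_diff: "eval_hom \<phi> l (p - q) = eval_hom \<phi> l p - eval_hom \<phi> l q"
  using eval_hom_add[of l p "- q"] by (simp add: eval_hom_uminus)

lemma eval_hom_sum: "eval_hom \<phi> l (\<Sum>i\<in>I. p i) = (\<Sum>i\<in>I. eval_hom \<phi> l (p i))"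
  by (induction I rule: infinite_finite_induct) (auto simp: eval_hom_0 eval_hom_add)

lemma eval_hom_single: "eval_hom \<phi> l (single t c) = \<phi> c * eval_monom l t"
  by (simp add: eval_hom_def \<phi>_0)

lemma eval_hom_mult: "eval_hom \<phi> l (p * q) = eval_hom \<phi> l p * eval_hom \<phi> l q"
proof -
  have "p * q = (\<Sum>s\<in>keys p. single s (lookup p s)) * (\<Sum>t\<in>keys q. single t (lookup q t))"
    by (simp only: poly_mapping_sum_single)
  also have "\<dots> = (\<Sum>s\<in>keys p. \<Sum>t\<in>keys q. single (s + t) (lookup p s * lookup q t))"
    by (simp add: sum_product mult_single)
  finally have "eval_hom \<phi> l (p * q) = (\<Sum>s\<in>keys p. \<Sum>t\<in>keys q.
      (\<phi> (lookup p s) * eval_monom l s) * (\<phi> (lookup q t) * eval_monom l t))"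
    by (simp add: eval_hom_sum eval_hom_single eval_monom_add \<phi>_mult ac_simps)
  then show ?thesis
    by (simp only: eval_hom_def sum_product)
qed

lemma eval_hom_Const: "eval_hom \<phi> l (Const c) = \<phi> c"
  by (simp add: Const_def eval_hom_single eval_monom_def)

lemma eval_hom_1: "eval_hom \<phi> l 1 = 1"
  using eval_hom_single[of l 0 1] by (simp add: eval_monom_def \<phi>_1)

lemma eval_hom_Var: "eval_hom \<phi> l (Var v) = l v"
  by (simp add: Var_def eval_hom_single eval_monom_def \<phi>_1)

lemma eval_hom_ring_hom: "eval_hom \<phi> l \<in> ring_hom (mpoly_ring V) ring_of_type_algebra"
  by (rule ring_hom_memI) (auto simp: eval_hom_mult eval_hom_add eval_hom_1)

end

section \<open>Universal properties of the polynomial ring and its quotient\<close>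

lemma single_prod_Var: "(single t 1 :: 'k::comm_ring_1 mpol) = (\<Prod>v\<in>keys t. Var v ^ lookup t v)"
proof -
  have "(\<Prod>v\<in>K. Var v ^ lookup t v) = (single (\<Sum>v\<in>K. single v (lookup t v)) 1 :: 'k mpol)" for K
    by (induction K rule: infinite_finite_induct)
      (simp_all add: Var_def single_single_power mult_single del: One_nat_def)
  moreover have "(\<Sum>v\<in>keys t. single v (lookup t v)) = t"
    by (rule poly_mapping_sum_single)
  ultimately show ?thesis
    by simp
qed

lemma poly_ring_hom_eq_eval_hom:
  fixes g :: "'k::comm_ring_1 mpol \<Rightarrow> 'r::comm_ring_1"
  assumes g: "g \<in> ring_hom (mpoly_ring V) ring_of_type_algebra" and c: "\<And>c. g (Const c) = \<phi> c"
    and p: "p \<in> polys V"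
  shows "g p = eval_hom \<phi> (\<lambda>v. g (Var v)) p"
proof -
  have add: "g (p + q) = g p + g q" and mult: "g (p * q) = g p * g q"
    if "p \<in> polys V" "q \<in> polys V" for p q
    using ring_hom_add[OF g, of p q] ring_hom_mult[OF g, of p q] that by simp_all
  have one: "g 1 = 1"
    using ring_hom_one[OF g] by simp
  have zero: "g 0 = 0"
    using add[OF polys_0 polys_0] by simp
  have power: "g (p ^ n) = g p ^ n" if "p \<in> polys V" for p n
    by (induction n) (auto simp: one mult polys_power that)
  have prod: "g (\<Prod>v\<in>K. Var v ^ e v) = (\<Prod>v\<in>K. g (Var v) ^ e v)" if "finite K" "K \<subseteq> V" for K e
    using that
  proof (induction K rule: finite_induct)
    case (insert v K)
    have "g (Var v ^ e v * (\<Prod>v\<in>K. Var v ^ e v)) = g (Var v ^ e v) * g (\<Prod>v\<in>K. Var v ^ e v)"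
      using insert.prems by (intro mult polys_prod polys_power polys_Var) auto
    then show ?case
      using insert by (simp add: power polys_Var)
  qed (simp add: one)
  have monom: "g (single t c) = \<phi> c * eval_monom (\<lambda>v. g (Var v)) t" if "keys t \<subseteq> V" for t c
  proof -
    have "single t c = Const c * single t 1"
      by (simp add: Const_def mult_single)
    also have "g \<dots> = \<phi> c * g (single t 1)"
      using that by (simp add: mult polys_Const polys_single c)
    also have "g (single t 1) = eval_monom (\<lambda>v. g (Var v)) t"
      unfolding eval_monom_def single_prod_Var by (rule prod) (use that in auto)
    finally show ?thesis .
  qed
  have keys_V: "keys t \<subseteq> V" if "t \<in> keys p" for t
    using p that by (auto simp: polys_def)
  have "g (\<Sum>t\<in>K. single t (lookup p t)) = (\<Sum>t\<in>K. \<phi> (lookup p t) * eval_monom (\<lambda>v. g (Var v)) t)"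
    if "finite K" "K \<subseteq> keys p" for K
    using that
  proof (induction K rule: finite_induct)
    case (insert t K)
    have "g (single t (lookup p t) + (\<Sum>t\<in>K. single t (lookup p t))) =
        g (single t (lookup p t)) + g (\<Sum>t\<in>K. single t (lookup p t))"
      using insert.prems keys_V by (intro add polys_single polys_sum) auto
    then show ?case
      using insert keys_V by (simp add: monom)
  qed (simp add: zero)
  from this[OF _ order_refl] show ?thesis
    by (simp add: poly_mapping_sum_single eval_hom_def)
qed

text \<open>A homomorphism from the quotient is determined by the images of the variables, and a
  family \<open>l\<close> of images occurs exactly when evaluation at \<open>l\<close> kills the
  generators of the ideal.\<close>

theorem bij_betw_hom_coords:
  fixes \<phi> :: "'k::comm_ring_1 \<Rightarrow> 'r::comm_ring_1"
  assumes hom: "\<phi> \<in> ring_hom ring_of_type_algebra ring_of_type_algebra"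
    and rel: "relations m \<Gamma> a \<subseteq> (polys (vars m \<Gamma>) :: 'k mpol set)"
  shows "bij_betw (hom_coords m \<Gamma> a) (alg_homs \<phi> m \<Gamma> a)
    {l \<in> vars m \<Gamma> \<rightarrow>\<^sub>E UNIV. \<forall>p\<in>relations m \<Gamma> a. eval_hom \<phi> l p = 0}"
proof -
  interpret coeff_hom \<phi>
    by unfold_locales (rule hom)
  define V where "V = vars m \<Gamma>"
  define I where "I = (rel_ideal m \<Gamma> a :: 'k mpol set)"
  let ?P = "mpoly_ring V :: 'k mpol ring"
  let ?R = "ring_of_type_algebra :: 'r ring"
  interpret P: cring ?P
    by (rule cring_poly_ring)
  interpret R: cring ?R
    by (rule cring_type_algebra)
  have I_gen: "I = genideal ?P (relations m \<Gamma> a)"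
    by (simp add: I_def rel_ideal_def P_ring_eq V_def)
  interpret I: ideal I ?P
    unfolding I_gen by (rule P.genideal_ideal) (use rel in \<open>simp add: V_def\<close>)
  define cl where "cl = (\<lambda>p. I +>\<^bsub>?P\<^esub> p)"
  have cls: "cls m \<Gamma> a p = cl p" for p
    by (simp add: cls_def cl_def I_def P_ring_eq V_def)
  have Q: "factor_alg m \<Gamma> a = ?P Quot I"
    by (simp add: factor_alg_def I_def P_ring_eq V_def)
  have cl_hom: "cl \<in> ring_hom ?P (?P Quot I)"
    unfolding cl_def by (rule I.rcos_ring_hom)
  have carrier_Q: "carrier (?P Quot I) = cl ` polys V"
    unfolding FactRing_simps cl_def by auto
  have I_cl: "cl p = \<zero>\<^bsub>?P Quot I\<^esub>" if "p \<in> I" for p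
    using P.a_rcos_zero[OF I.is_ideal that] by (simp add: cl_def FactRing_def)
  interpret Q: cring "?P Quot I"
    by (rule I.quotient_is_cring[OF P.is_cring])
  have eq: "h (cl p) = eval_hom \<phi> (hom_coords m \<Gamma> a h) p"
    if h: "h \<in> alg_homs \<phi> m \<Gamma> a" and p: "p \<in> polys V" for h p
  proof -
    have hom_h: "h \<in> ring_hom (?P Quot I) ?R" and h_const: "\<And>c. h (cl (Const c)) = \<phi> c"
      using h by (auto simp: alg_homs_def Q cls)
    have "(h \<circ> cl) p = eval_hom \<phi> (\<lambda>v. (h \<circ> cl) (Var v)) p"
      by (rule poly_ring_hom_eq_eval_hom[OF ring_hom_trans[OF cl_hom hom_h] _ p]) (simp add: h_const)
    also have "\<dots> = eval_hom \<phi> (hom_coords m \<Gamma> a h) p"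
      by (rule eval_hom_cong[OF p]) (simp add: hom_coords_def cls V_def)
    finally show ?thesis
      by simp
  qed
  have inj: "inj_on (hom_coords m \<Gamma> a) (alg_homs \<phi> m \<Gamma> a)"
  proof (rule inj_onI)
    fix h h' assume h: "h \<in> alg_homs \<phi> m \<Gamma> a" "h' \<in> alg_homs \<phi> m \<Gamma> a"
      "hom_coords m \<Gamma> a h = hom_coords m \<Gamma> a h'"
    show "h = h'"
    proof (rule extensionalityI)
      show "h \<in> extensional (carrier (factor_alg m \<Gamma> a))" "h' \<in> extensional (carrier (factor_alg m \<Gamma> a))"
        using h by (auto simp: alg_homs_def)
      fix Z assume "Z \<in> carrier (factor_alg m \<Gamma> a :: 'k mpol set ring)"
      then obtain p where "Z = cl p" "p \<in> polys V"
        unfolding Q carrier_Q by blast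
      then show "h Z = h' Z"
        using eq[OF h(1)] eq[OF h(2)] h(3) by simp
    qed
  qed
  have into: "hom_coords m \<Gamma> a h \<in> {l \<in> vars m \<Gamma> \<rightarrow>\<^sub>E UNIV. \<forall>p\<in>relations m \<Gamma> a. eval_hom \<phi> l p = 0}"
    if h: "h \<in> alg_homs \<phi> m \<Gamma> a" for h
  proof -
    have hom_h: "h \<in> ring_hom (?P Quot I) ?R"
      using h by (auto simp: alg_homs_def Q)
    have "eval_hom \<phi> (hom_coords m \<Gamma> a h) p = 0" if p: "p \<in> relations m \<Gamma> a" for p
    proof -
      have "p \<in> I"
        using P.genideal_self[of "relations m \<Gamma> a"] rel p unfolding I_gen V_def by auto
      have "eval_hom \<phi> (hom_coords m \<Gamma> a h) p = h (cl p)"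
        using eq[OF h, of p] rel p by (auto simp: V_def)
      also have "\<dots> = 0"
        unfolding I_cl[OF \<open>p \<in> I\<close>]
        using ring_hom_zero[OF hom_h Q.ring_axioms R.ring_axioms] by simp
      finally show ?thesis .
    qed
    moreover have "hom_coords m \<Gamma> a h \<in> vars m \<Gamma> \<rightarrow>\<^sub>E UNIV"
      by (simp add: hom_coords_def)
    ultimately show ?thesis
      by blast
  qed
  have onto: "\<exists>h\<in>alg_homs \<phi> m \<Gamma> a. hom_coords m \<Gamma> a h = l"
    if l: "l \<in> vars m \<Gamma> \<rightarrow>\<^sub>E UNIV" "\<forall>p\<in>relations m \<Gamma> a. eval_hom \<phi> l p = 0" for l
  proof -
    have "ring_hom_ring ?P ?R (eval_hom \<phi> l)"
      by (rule ring_hom_ringI2[OF P.ring_axioms R.ring_axioms eval_hom_ring_hom])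
    note kernel = ring_hom_ring.kernel_is_ideal[OF this]
    have I_0: "eval_hom \<phi> l p = 0" if "p \<in> I" for p
    proof -
      have "I \<subseteq> a_kernel ?P ?R (eval_hom \<phi> l)"
        unfolding I_gen
        by (rule P.genideal_minimal[OF kernel]) (use rel l(2) in \<open>auto simp: a_kernel_def' V_def\<close>)
      then show ?thesis
        using that by (auto simp: a_kernel_def')
    qed
    \<comment> \<open>Evaluation is constant on every coset of \<open>I\<close>, so the image of a
      coset is a singleton and \<open>the_elem\<close> reads off its value.\<close>
    define h where "h = (\<lambda>Z\<in>carrier (?P Quot I). the_elem (eval_hom \<phi> l ` Z))"
    have h_cl: "h (cl p) = eval_hom \<phi> l p" if p: "p \<in> polys V" for p
    proof -
      have "eval_hom \<phi> l ` cl p = {eval_hom \<phi> l p}"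
      proof -
        have "cl p = {i + p |i. i \<in> I}"
          unfolding cl_def a_r_coset_def' by auto
        then show ?thesis
          using I.zero_closed by (auto simp: eval_hom_add I_0)
      qed
      then show ?thesis
        using p by (simp add: h_def carrier_Q)
    qed
    have "h \<in> ring_hom (?P Quot I) ?R"
    proof (rule ring_hom_memI)
      fix Z Y assume "Z \<in> carrier (?P Quot I)" "Y \<in> carrier (?P Quot I)"
      then obtain p q where p: "Z = cl p" "p \<in> polys V" and q: "Y = cl q" "q \<in> polys V"
        unfolding carrier_Q by blast
      have "Z \<otimes>\<^bsub>?P Quot I\<^esub> Y = cl (p * q)" "Z \<oplus>\<^bsub>?P Quot I\<^esub> Y = cl (p + q)"
        using ring_hom_mult[OF cl_hom, of p q] ring_hom_add[OF cl_hom, of p q] p q by simp_all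
      then show "h (Z \<otimes>\<^bsub>?P Quot I\<^esub> Y) = h Z \<otimes>\<^bsub>?R\<^esub> h Y" "h (Z \<oplus>\<^bsub>?P Quot I\<^esub> Y) = h Z \<oplus>\<^bsub>?R\<^esub> h Y"
        using p q by (simp_all add: h_cl polys_mult polys_add eval_hom_mult eval_hom_add)
    next
      have "\<one>\<^bsub>?P Quot I\<^esub> = cl 1"
        using ring_hom_one[OF cl_hom] by simp
      then show "h \<one>\<^bsub>?P Quot I\<^esub> = \<one>\<^bsub>?R\<^esub>"
        by (simp add: h_cl polys_1 eval_hom_1)
    qed simp
    moreover have "h \<in> extensional (carrier (?P Quot I))"
      by (simp add: h_def)
    ultimately have "h \<in> alg_homs \<phi> m \<Gamma> a"
      by (simp add: alg_homs_def Q cls h_cl polys_Const eval_hom_Const)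
    moreover have "hom_coords m \<Gamma> a h = l"
      using l(1) by (auto simp: hom_coords_def cls h_cl polys_Var V_def eval_hom_Var PiE_def
          extensional_def fun_eq_iff)
    ultimately show ?thesis
      by blast
  qed
  show ?thesis
    unfolding bij_betw_def using inj into onto by blast
qed

section \<open>Points and solutions of the relations\<close>

text \<open>This concerns the term of lowest degree: \<open>x^k\<close> plus higher terms, the shape
  of the canonical elements.\<close>

definition lead :: "nat \<Rightarrow> 'a::comm_ring_1 poly \<Rightarrow> bool"
  where "lead k p \<longleftrightarrow> coeff p k = 1 \<and> (\<forall>i<k. coeff p i = 0)"

lemma lead_mult:
  assumes "lead j p" "lead k q"
  shows "lead (j + k) (p * q)"
proof -
  have "coeff p i * coeff q (n - i) = (if n = j + k \<and> i = j then 1 else 0)"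
    if "n \<le> j + k" "i \<le> n" for n i
  proof (cases "i < j \<or> n - i < k")
    case True
    then show ?thesis
      using assms that by (auto simp: lead_def)
  next
    case False
    then have "i = j" "n = j + k"
      using that by auto
    then show ?thesis
      using assms by (simp add: lead_def)
  qed
  then have "coeff (p * q) n = (\<Sum>i\<le>n. if n = j + k \<and> i = j then 1 else 0)" if "n \<le> j + k" for n
    unfolding coeff_mult using that by (intro sum.cong refl) auto
  then show ?thesis
    by (auto simp: lead_def)
qed

lemma lead_1: "lead 0 1"
  by (simp add: lead_def)

lemma lead_power: "lead k p \<Longrightarrow> lead (n * k) (p ^ n)"
  by (induction n) (auto simp: lead_1 lead_mult)

lemma lead_prod: "(\<And>i. i \<in> I \<Longrightarrow> lead (k i) (p i)) \<Longrightarrow> lead (\<Sum>i\<in>I. k i) (\<Prod>i\<in>I. p i)"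
  by (induction I rule: infinite_finite_induct) (auto simp: lead_1 lead_mult)

text \<open>The values \<open>l\<close> may lie in any ring; \<open>l = Var\<close> gives back the
  generic \<open>gen\<close>, so facts about lowest terms are proved once for both.\<close>

definition spec_gen :: "nat \<Rightarrow> nat set \<Rightarrow> (nat \<times> nat \<Rightarrow> 'r) \<Rightarrow> nat \<Rightarrow> 'r::comm_ring_1 poly"
  where "spec_gen m \<Gamma> l \<nu> = monom 1 \<nu> + (\<Sum>j\<in>gaps m \<Gamma> \<nu>. monom (l (\<nu>, j)) j)"

definition spec_pow :: "nat \<Rightarrow> nat set \<Rightarrow> (nat \<times> nat \<Rightarrow> 'r) \<Rightarrow> (nat \<Rightarrow> nat) \<Rightarrow> 'r::comm_ring_1 poly"
  where "spec_pow m \<Gamma> l b = (\<Prod>\<nu>\<in>ind \<Gamma>. spec_gen m \<Gamma> l \<nu> ^ b \<nu>)"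

lemma gen_eq_spec_gen: "gen m \<Gamma> \<nu> = spec_gen m \<Gamma> Var \<nu>"
  by (simp add: gen_def spec_gen_def)

lemma gen_pow_eq_spec_pow: "gen_pow m \<Gamma> b = spec_pow m \<Gamma> Var b"
  by (simp add: gen_pow_def spec_pow_def gen_eq_spec_gen)

lemma finite_gaps: "finite (gaps m \<Gamma> k)"
  by (rule finite_subset[of _ "{..m}"]) (auto simp: gaps_def)

lemma coeff_spec_gen:
  "coeff (spec_gen m \<Gamma> l \<nu>) j = (if j = \<nu> then 1 else if j \<in> gaps m \<Gamma> \<nu> then l (\<nu>, j) else 0)"
  using finite_gaps[of m \<Gamma> \<nu>] by (auto simp: spec_gen_def coeff_sum gaps_def)

lemma lead_spec_gen: "lead \<nu> (spec_gen m \<Gamma> l \<nu>)"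
  by (auto simp: lead_def coeff_spec_gen gaps_def)

lemma lead_spec_pow: "b \<in> Rel \<Gamma> \<gamma> \<Longrightarrow> lead \<gamma> (spec_pow m \<Gamma> l b)"
  using lead_prod[of "ind \<Gamma>" "\<lambda>\<nu>. b \<nu> * \<nu>" "\<lambda>\<nu>. spec_gen m \<Gamma> l \<nu> ^ b \<nu>"]
  by (simp add: spec_pow_def Rel_def lead_power lead_spec_gen)

lemma spec_pow_add:
  "spec_pow m \<Gamma> l (\<lambda>i. b i + b' i) = spec_pow m \<Gamma> l b * spec_pow m \<Gamma> l b'"
  by (simp add: spec_pow_def power_add prod.distrib)

context coeff_hom
begin

lemma coeff_eval_mult:
  assumes "\<And>j. coeff p' j = eval_hom \<phi> l (coeff p j)" "\<And>j. coeff q' j = eval_hom \<phi> l (coeff q j)"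
  shows "coeff (p' * q') j = eval_hom \<phi> l (coeff (p * q) j)"
  by (simp add: coeff_mult assms eval_hom_sum eval_hom_mult)

text \<open>Coefficients of a product are sums of products of coefficients, so evaluation passes
  through powers and products degree by degree.\<close>

lemma coeff_spec_pow_eq_eval:
  "coeff (spec_pow m \<Gamma> l b) j = eval_hom \<phi> l (coeff (gen_pow m \<Gamma> b) j)"
proof -
  have gen: "coeff (spec_gen m \<Gamma> l \<nu>) j = eval_hom \<phi> l (coeff (spec_gen m \<Gamma> Var \<nu>) j)" for \<nu> j
    by (auto simp: coeff_spec_gen eval_hom_1 eval_hom_0 eval_hom_Var)
  have one: "coeff (1 :: 'r poly) j = eval_hom \<phi> l (coeff 1 j)" for j
    by (auto simp: eval_hom_1 eval_hom_0)
  have pow: "coeff (spec_gen m \<Gamma> l \<nu> ^ n) j = eval_hom \<phi> l (coeff (spec_gen m \<Gamma> Var \<nu> ^ n) j)" for \<nu> n j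
  proof (induction n arbitrary: j)
    case (Suc n)
    show ?case
      unfolding power_Suc by (rule coeff_eval_mult[OF gen Suc])
  qed (simp only: power_0 one)
  have "coeff (\<Prod>\<nu>\<in>K. spec_gen m \<Gamma> l \<nu> ^ b \<nu>) j = eval_hom \<phi> l (coeff (\<Prod>\<nu>\<in>K. spec_gen m \<Gamma> Var \<nu> ^ b \<nu>) j)"
    for K j
  proof (induction K arbitrary: j rule: infinite_finite_induct)
    case (insert \<nu> K)
    show ?case
      unfolding prod.insert[OF insert.hyps] by (rule coeff_eval_mult[OF pow insert.IH])
  next
    case (infinite K)
    show ?case
      unfolding prod.infinite[OF infinite] by (rule one)
  qed (simp only: prod.empty one)
  then show ?thesis
    by (simp only: spec_pow_def gen_pow_eq_spec_pow)
qed

lemma eval_relation: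
  "eval_hom \<phi> l (relation m \<Gamma> a \<gamma> b j) = coeff (spec_pow m \<Gamma> l b) j -
    coeff (spec_pow m \<Gamma> l (a \<gamma>) + (\<Sum>\<gamma>'\<in>above \<Gamma> \<gamma>.
      smult (eval_hom \<phi> l (theta m \<Gamma> a \<gamma> b \<gamma>')) (spec_pow m \<Gamma> l (a \<gamma>')))) j"
  by (simp add: relation_def eval_hom_diff eval_hom_add eval_hom_sum eval_hom_mult coeff_sum
      coeff_spec_pow_eq_eval)

end

section \<open>Representations of elements of \<Gamma> and the module they span\<close>

locale relations_setup =
  fixes m :: nat and \<Gamma> :: "nat set" and a :: "nat \<Rightarrow> nat \<Rightarrow> nat"
  assumes m: "4 \<le> m"
    and semi: "\<Gamma> \<in> semi_sets m"
    and a_dec: "\<And>\<gamma>. \<gamma> \<in> dec \<Gamma> \<Longrightarrow> a \<gamma> \<in> Rel \<Gamma> \<gamma>"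
    and a_ind: "\<And>\<nu>. \<nu> \<in> ind \<Gamma> \<Longrightarrow> a \<nu> = unit_vec \<nu>"
begin

lemma \<Gamma>_bounds:
  assumes "\<gamma> \<in> \<Gamma>"
  shows "2 \<le> \<gamma>" "\<gamma> < m"
proof -
  have "\<gamma> \<in> {2..m - 2}"
    using assms semi unfolding semi_sets_def by blast
  then show "2 \<le> \<gamma>" "\<gamma> < m"
    using m by auto
qed

lemma finite_\<Gamma>: "finite \<Gamma>"
  by (rule finite_subset[of _ "{..<m}"]) (auto dest: \<Gamma>_bounds)

lemma \<Gamma>_add:
  assumes "x \<in> \<Gamma>" "y \<in> \<Gamma>" "x + y < m"
  shows "x + y \<in> dec \<Gamma>"
proof -
  have "\<forall>x\<in>\<Gamma>. \<forall>y\<in>\<Gamma>. x + y \<in> \<Gamma> \<or> m \<le> x + y"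
    using semi by (simp add: semi_sets_def)
  then have "x + y \<in> \<Gamma>"
    using assms by (meson not_le)
  then show ?thesis
    using assms(1,2) by (auto simp: dec_def)
qed

lemma finite_ind: "finite (ind \<Gamma>)"
  using finite_\<Gamma> by (simp add: ind_def)

lemma ind_subset: "ind \<Gamma> \<subseteq> \<Gamma>"
  by (auto simp: ind_def)

lemma dec_subset: "dec \<Gamma> \<subseteq> \<Gamma>"
  by (auto simp: dec_def)

text \<open>Every \<nu> is positive, which bounds each entry by \<gamma>. Finiteness matters because
  \<open>card\<close>, used in \<open>dec2\<close> and \<open>n_eqs\<close>, is 0 on infinite
  sets.\<close>

lemma finite_Rel: "finite (Rel \<Gamma> \<gamma>)"
proof (rule finite_subset)
  show "Rel \<Gamma> \<gamma> \<subseteq> {b. \<forall>i. (i \<in> ind \<Gamma> \<longrightarrow> b i \<in> {..\<gamma>}) \<and> (i \<notin> ind \<Gamma> \<longrightarrow> b i = 0)}"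
  proof (intro subsetI CollectI allI conjI impI)
    fix b i assume b: "b \<in> Rel \<Gamma> \<gamma>"
    show "b i = 0" if "i \<notin> ind \<Gamma>"
      using b that by (simp add: Rel_def)
    show "b i \<in> {..\<gamma>}" if i: "i \<in> ind \<Gamma>"
    proof -
      have "b i \<le> b i * i"
        using \<Gamma>_bounds(1)[of i] i ind_subset by auto
      also have "\<dots> \<le> (\<Sum>\<nu>\<in>ind \<Gamma>. b \<nu> * \<nu>)"
        using finite_ind i by (intro member_le_sum) auto
      finally show ?thesis
        using b by (simp add: Rel_def)
    qed
  qed
qed (intro finite_set_of_finite_funs finite_ind finite_atMost)

lemma unit_vec_Rel: "\<nu> \<in> ind \<Gamma> \<Longrightarrow> unit_vec \<nu> \<in> Rel \<Gamma> \<nu>"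
  using finite_ind by (auto simp: Rel_def unit_vec_def if_distrib if_distribR cong: if_cong)

lemma a_Rel: "\<gamma> \<in> \<Gamma> \<Longrightarrow> a \<gamma> \<in> Rel \<Gamma> \<gamma>"
  using a_dec a_ind unit_vec_Rel by (cases "\<gamma> \<in> dec \<Gamma>") (auto simp: ind_def)

lemma Rel_add: "b \<in> Rel \<Gamma> x \<Longrightarrow> b' \<in> Rel \<Gamma> y \<Longrightarrow> (\<lambda>i. b i + b' i) \<in> Rel \<Gamma> (x + y)"
  by (auto simp: Rel_def distrib_right sum.distrib)

lemma dec2I:
  assumes "\<gamma> \<in> dec \<Gamma>" "b \<in> Rel \<Gamma> \<gamma>" "b \<noteq> a \<gamma>"
  shows "\<gamma> \<in> dec2 \<Gamma>"
proof -
  have "card {b, a \<gamma>} \<le> card (Rel \<Gamma> \<gamma>)"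
    using assms a_dec finite_Rel by (intro card_mono) auto
  then show ?thesis
    using assms by (simp add: dec2_def)
qed

lemma spec_pow_unit_vec: "\<nu> \<in> ind \<Gamma> \<Longrightarrow> spec_pow m \<Gamma> l (unit_vec \<nu>) = spec_gen m \<Gamma> l \<nu>"
  using finite_ind
  by (simp add: spec_pow_def unit_vec_def if_distrib[of "\<lambda>n. _ ^ n"] prod.delta cong: if_cong)

lemma lead_a: "\<gamma> \<in> \<Gamma> \<Longrightarrow> lead \<gamma> (spec_pow m \<Gamma> l (a \<gamma>))"
  by (rule lead_spec_pow[OF a_Rel])

text \<open>Up to degree \<gamma> both products have the same coefficients, and in a degree of
  \<Gamma> above \<gamma> the relation is just the system solved by \<open>theta\<close>. Only the
  gaps carry genuine conditions.\<close>

lemma relation_eq_0: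
  assumes \<gamma>: "\<gamma> \<in> \<Gamma>" and b: "b \<in> Rel \<Gamma> \<gamma>" and j: "j \<le> \<gamma> \<or> j \<in> \<Gamma>"
  shows "relation m \<Gamma> a \<gamma> b j = (0 :: 'k::comm_ring_1 mpol)"
proof -
  let ?c = "\<lambda>b. coeff (gen_pow m \<Gamma> b :: 'k mpol poly)"
  have lead: "lead \<delta> (gen_pow m \<Gamma> b' :: 'k mpol poly)" if "b' \<in> Rel \<Gamma> \<delta>" for b' \<delta>
    unfolding gen_pow_eq_spec_pow using that by (rule lead_spec_pow)
  have zero: "?c (a \<gamma>') j = 0" if "\<gamma>' \<in> \<Gamma>" "j < \<gamma>'" for \<gamma>'
    using lead[OF a_Rel[OF that(1)]] that(2) by (simp add: lead_def)
  show ?thesis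
  proof (cases "j \<le> \<gamma>")
    case True
    have "?c b j = ?c (a \<gamma>) j"
      using lead[OF b] lead[OF a_Rel[OF \<gamma>]] True by (cases "j = \<gamma>") (auto simp: lead_def)
    moreover have "(\<Sum>\<gamma>'\<in>above \<Gamma> \<gamma>. theta m \<Gamma> a \<gamma> b \<gamma>' * ?c (a \<gamma>') j) = 0"
      by (rule sum.neutral) (use True zero in \<open>auto simp: above_def\<close>)
    ultimately show ?thesis
      by (simp add: relation_def)
  next
    case False
    then have ab: "j \<in> above \<Gamma> \<gamma>"
      using j by (simp add: above_def)
    have fin: "finite (above \<Gamma> \<gamma>)"
      using finite_\<Gamma> by (simp add: above_def)
    \<comment> \<open>Products with index beyond \<open>j\<close> start above degree
      \<open>j\<close>. What remains are the indices between \<gamma> and \<open>j\<close> and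
      \<open>j\<close> itself, whose coefficient is 1: the equation of the system at
      \<open>j\<close>.\<close>
    have "(\<Sum>\<gamma>'\<in>above \<Gamma> \<gamma>. theta m \<Gamma> a \<gamma> b \<gamma>' * ?c (a \<gamma>') j) =
      (\<Sum>\<gamma>'\<in>insert j (between \<Gamma> \<gamma> j). theta m \<Gamma> a \<gamma> b \<gamma>' * ?c (a \<gamma>') j)"
    proof (rule sum.mono_neutral_right[OF fin])
      show "insert j (between \<Gamma> \<gamma> j) \<subseteq> above \<Gamma> \<gamma>"
        using ab by (auto simp: above_def between_def)
      show "\<forall>\<gamma>'\<in>above \<Gamma> \<gamma> - insert j (between \<Gamma> \<gamma> j). theta m \<Gamma> a \<gamma> b \<gamma>' * ?c (a \<gamma>') j = 0"
      proof
        fix \<gamma>' assume "\<gamma>' \<in> above \<Gamma> \<gamma> - insert j (between \<Gamma> \<gamma> j)"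
        then have "\<gamma>' \<in> \<Gamma>" "j < \<gamma>'"
          by (auto simp: above_def between_def)
        then show "theta m \<Gamma> a \<gamma> b \<gamma>' * ?c (a \<gamma>') j = 0"
          by (simp add: zero)
      qed
    qed
    also have "\<dots> = theta m \<Gamma> a \<gamma> b j * ?c (a j) j +
        (\<Sum>\<gamma>'\<in>between \<Gamma> \<gamma> j. theta m \<Gamma> a \<gamma> b \<gamma>' * ?c (a \<gamma>') j)"
      using finite_\<Gamma> by (subst sum.insert) (auto simp: between_def)
    also have "?c (a j) j = 1"
      using lead[OF a_Rel] ab by (auto simp: lead_def above_def)
    also have "theta m \<Gamma> a \<gamma> b j * 1 + (\<Sum>\<gamma>'\<in>between \<Gamma> \<gamma> j. theta m \<Gamma> a \<gamma> b \<gamma>' * ?c (a \<gamma>') j) =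
        ?c b j - ?c (a \<gamma>) j"
      using theta_system[OF ab, of m a b] by simp
    finally show ?thesis
      by (simp add: relation_def)
  qed
qed

text \<open>The candidate for the point with coordinates \<open>l\<close>. The module operations and
  the conditions on \<open>low_coeffs\<close> hold for all values \<open>l\<close>; closure under
  multiplication is where the relations enter.\<close>

definition span_alg :: "(nat \<times> nat \<Rightarrow> 'r) \<Rightarrow> 'r::comm_ring_1 poly set"
  where "span_alg l = {[:c:] + (\<Sum>\<gamma>\<in>\<Gamma>. smult (r \<gamma>) (spec_pow m \<Gamma> l (a \<gamma>))) + monom 1 m * g |c r g. True}"

lemma span_algI:
  "f = [:c:] + (\<Sum>\<gamma>\<in>\<Gamma>. smult (r \<gamma>) (spec_pow m \<Gamma> l (a \<gamma>))) + monom 1 m * g \<Longrightarrow> f \<in> span_alg l"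
  unfolding span_alg_def by blast

lemma span_algE:
  assumes "f \<in> span_alg l"
  obtains c r g where
    "f = [:c:] + (\<Sum>\<gamma>\<in>\<Gamma>. smult (r \<gamma>) (spec_pow m \<Gamma> l (a \<gamma>))) + monom 1 m * g"
  using assms unfolding span_alg_def by blast

lemma span_alg_const: "[:c:] \<in> span_alg l"
  by (rule span_algI[of _ c "\<lambda>_. 0" l 0]) simp

lemma span_alg_monom_mult: "monom 1 m * g \<in> span_alg l"
  by (rule span_algI[of _ 0 "\<lambda>_. 0" l g]) simp

lemma span_alg_basis: "\<gamma> \<in> \<Gamma> \<Longrightarrow> spec_pow m \<Gamma> l (a \<gamma>) \<in> span_alg l"
  by (rule span_algI[of _ 0 "\<lambda>\<gamma>'. if \<gamma>' = \<gamma> then 1 else 0" l 0])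
    (simp add: if_distrib[of "\<lambda>c. smult c _"] sum.delta finite_\<Gamma> cong: if_cong)

lemma span_alg_add:
  assumes "f \<in> span_alg l" "f' \<in> span_alg l"
  shows "f + f' \<in> span_alg l"
proof -
  obtain c r g where f: "f = [:c:] + (\<Sum>\<gamma>\<in>\<Gamma>. smult (r \<gamma>) (spec_pow m \<Gamma> l (a \<gamma>))) + monom 1 m * g"
    using assms(1) by (rule span_algE)
  obtain c' r' g' where f': "f' = [:c':] + (\<Sum>\<gamma>\<in>\<Gamma>. smult (r' \<gamma>) (spec_pow m \<Gamma> l (a \<gamma>))) + monom 1 m * g'"
    using assms(2) by (rule span_algE)
  have c: "[:c + c':] = [:c:] + [:c':]"
    by simp
  show ?thesis
    by (rule span_algI[of _ "c + c'" "\<lambda>\<gamma>. r \<gamma> + r' \<gamma>" l "g + g'"])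
      (unfold f f' c smult_add_left sum.distrib distrib_left, simp only: ac_simps)
qed

lemma span_alg_smult:
  assumes "f \<in> span_alg l"
  shows "smult d f \<in> span_alg l"
proof -
  obtain c r g where f: "f = [:c:] + (\<Sum>\<gamma>\<in>\<Gamma>. smult (r \<gamma>) (spec_pow m \<Gamma> l (a \<gamma>))) + monom 1 m * g"
    using assms by (rule span_algE)
  have "smult d (\<Sum>\<gamma>\<in>\<Gamma>. smult (r \<gamma>) (spec_pow m \<Gamma> l (a \<gamma>))) =
      (\<Sum>\<gamma>\<in>\<Gamma>. smult (d * r \<gamma>) (spec_pow m \<Gamma> l (a \<gamma>)))"
    by (rule poly_eqI) (simp add: coeff_sum sum_distrib_left mult.assoc)
  then show ?thesis
    by (intro span_algI[of _ "d * c" "\<lambda>\<gamma>. d * r \<gamma>" l "smult d g"]) (simp add: f smult_add_right)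
qed

lemma span_alg_sum: "(\<And>i. i \<in> I \<Longrightarrow> f i \<in> span_alg l) \<Longrightarrow> (\<Sum>i\<in>I. f i) \<in> span_alg l"
  using span_alg_const[of 0 l] by (induction I rule: infinite_finite_induct) (auto simp: span_alg_add)

lemma span_alg_congruent:
  assumes "f \<in> span_alg l" "\<And>i. i < m \<Longrightarrow> coeff f' i = coeff f i"
  shows "f' \<in> span_alg l"
proof -
  have "f' = f + monom 1 m * poly_shift m (f' - f)"
    by (rule poly_eqI) (use assms(2) in \<open>auto simp: coeff_monom_mult coeff_poly_shift\<close>)
  then show ?thesis
    using span_alg_add[OF assms(1) span_alg_monom_mult[of "poly_shift m (f' - f)" l]] by simp
qed

text \<open>The spanning products have distinct lowest terms with coefficient 1. By this
  triangularity, once the smaller multipliers vanish the coefficient in degree \<gamma> is the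
  single multiplier belonging to it.\<close>

lemma coeff_span:
  assumes "\<gamma> \<le> m - 1" and "\<And>\<delta>. \<delta> \<in> \<Gamma> \<Longrightarrow> \<delta> < \<gamma> \<Longrightarrow> r \<delta> = 0"
  shows "coeff ([:c:] + (\<Sum>\<gamma>\<in>\<Gamma>. smult (r \<gamma>) (spec_pow m \<Gamma> l (a \<gamma>))) + monom 1 m * g) \<gamma> =
    (if \<gamma> = 0 then c else if \<gamma> \<in> \<Gamma> then r \<gamma> else 0)"
proof -
  have "r \<delta> * coeff (spec_pow m \<Gamma> l (a \<delta>)) \<gamma> = (if \<delta> = \<gamma> then r \<gamma> else 0)" if "\<delta> \<in> \<Gamma>" for \<delta>
    using lead_a[OF that, of l] assms(2)[OF that] by (cases \<delta> \<gamma> rule: linorder_cases) (auto simp: lead_def)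
  then have "(\<Sum>\<delta>\<in>\<Gamma>. r \<delta> * coeff (spec_pow m \<Gamma> l (a \<delta>)) \<gamma>) = (\<Sum>\<delta>\<in>\<Gamma>. if \<delta> = \<gamma> then r \<gamma> else 0)"
    by (rule sum.cong[OF refl])
  then show ?thesis
    using assms(1) m \<Gamma>_bounds(1)[of 0] finite_\<Gamma>
    by (auto simp: coeff_sum coeff_monom_mult coeff_pCons split: nat.split)
qed

lemma low_coeffs_span_alg:
  assumes "\<gamma> \<in> {1..m - 1}"
  shows "low_coeffs (span_alg l) \<gamma> = (if \<gamma> \<in> \<Gamma> then UNIV else {0})"
proof (cases "\<gamma> \<in> \<Gamma>")
  case True
  have "c \<in> low_coeffs (span_alg l) \<gamma>" for c
    unfolding low_coeffs_def
    using span_alg_smult[OF span_alg_basis[OF True], of c l] lead_a[OF True, of l]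
    by (intro CollectI exI[of _ "smult c (spec_pow m \<Gamma> l (a \<gamma>))"]) (simp add: lead_def)
  then show ?thesis
    using True by auto
next
  case False
  have "coeff f \<gamma> = 0" if f: "f \<in> span_alg l" "\<forall>i<\<gamma>. coeff f i = 0" for f
  proof -
    obtain c r g where eq: "f = [:c:] + (\<Sum>\<gamma>\<in>\<Gamma>. smult (r \<gamma>) (spec_pow m \<Gamma> l (a \<gamma>))) + monom 1 m * g"
      using f(1) by (rule span_algE)
    \<comment> \<open>The multipliers below \<gamma> are read off from \<open>f\<close> one after
      another, from the lowest degree upwards, and found to be zero.\<close>
    have "\<delta> \<in> \<Gamma> \<longrightarrow> \<delta> < \<gamma> \<longrightarrow> r \<delta> = 0" for \<delta>
    proof (induction \<delta> rule: less_induct)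
      case (less \<delta>)
      show ?case
      proof (intro impI)
        assume \<delta>: "\<delta> \<in> \<Gamma>" "\<delta> < \<gamma>"
        have "coeff f \<delta> = r \<delta>"
          unfolding eq using less \<delta> assms \<Gamma>_bounds(1)[OF \<delta>(1)] by (subst coeff_span) auto
        then show "r \<delta> = 0"
          using f(2) \<delta>(2) by simp
      qed
    qed
    then show ?thesis
      unfolding eq using False assms by (subst coeff_span) auto
  qed
  moreover have "0 \<in> low_coeffs (span_alg l) \<gamma>"
    unfolding low_coeffs_def using span_alg_const[of 0 l] by (intro CollectI exI[of _ 0]) simp
  ultimately have "low_coeffs (span_alg l) \<gamma> = {0}"
    unfolding low_coeffs_def by blast
  then show ?thesis
    using False by simp
qed

end

section \<open>Solutions of the relations give subalgebras\<close>

locale relations_setup_hom = relations_setup m \<Gamma> a + coeff_hom \<phi>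
  for m \<Gamma> a and \<phi> :: "'k::comm_ring_1 \<Rightarrow> 'r::comm_ring_1"
begin

text \<open>The relations give the coefficients in the gaps and \<open>relation_eq_0\<close> gives
  all others below \<open>m\<close>, so the product agrees with an element of the module modulo
  \<open>x^m\<close>.\<close>

lemma spec_pow_in_span_alg:
  assumes sol: "\<forall>p\<in>relations m \<Gamma> a. eval_hom \<phi> l p = 0"
    and \<gamma>: "\<gamma> \<in> dec \<Gamma>" and b: "b \<in> Rel \<Gamma> \<gamma>"
  shows "spec_pow m \<Gamma> l b \<in> span_alg l"
proof (cases "b = a \<gamma>")
  case True
  then show ?thesis
    using \<gamma> dec_subset span_alg_basis by auto
next
  case False
  let ?f = "spec_pow m \<Gamma> l (a \<gamma>) + (\<Sum>\<gamma>'\<in>above \<Gamma> \<gamma>.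
    smult (eval_hom \<phi> l (theta m \<Gamma> a \<gamma> b \<gamma>')) (spec_pow m \<Gamma> l (a \<gamma>')))"
  have \<gamma>': "\<gamma> \<in> \<Gamma>"
    using \<gamma> dec_subset by blast
  have "eval_hom \<phi> l (relation m \<Gamma> a \<gamma> b j) = 0" if "j < m" for j
  proof (cases "j \<le> \<gamma> \<or> j \<in> \<Gamma>")
    case True
    then show ?thesis
      by (simp add: relation_eq_0[OF \<gamma>' b] eval_hom_0)
  next
    case False
    then have "(\<gamma>, b, j) \<in> rel_index m \<Gamma> a"
      using that \<gamma> b \<open>b \<noteq> a \<gamma>\<close> by (auto simp: rel_index_def gaps_def intro: dec2I)
    then have "relation m \<Gamma> a \<gamma> b j \<in> (relations m \<Gamma> a :: 'k mpol set)"
      unfolding relations_def by (rule image_eqI[rotated]) simp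
    then show ?thesis
      using sol by blast
  qed
  then have "coeff (spec_pow m \<Gamma> l b) j = coeff ?f j" if "j < m" for j
    using that by (simp add: eval_relation)
  moreover have "?f \<in> span_alg l"
    using \<gamma>' by (intro span_alg_add span_alg_sum span_alg_smult span_alg_basis) (auto simp: above_def)
  ultimately show ?thesis
    using span_alg_congruent by blast
qed

text \<open>A product of two spanning elements is the product for the sum of two exponent vectors,
  which represents \<gamma> + \<delta>; if that number is at least \<open>m\<close>, the product is
  divisible by \<open>x^m\<close>.\<close>

lemma span_alg_mult:
  assumes sol: "\<forall>p\<in>relations m \<Gamma> a. eval_hom \<phi> l p = 0"
    and "f \<in> span_alg l" "h \<in> span_alg l"
  shows "f * h \<in> span_alg l"
proof -
  let ?B = "\<lambda>\<gamma>. spec_pow m \<Gamma> l (a \<gamma>)"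
  have basis: "?B \<gamma> * ?B \<delta> \<in> span_alg l" if \<gamma>: "\<gamma> \<in> \<Gamma>" and \<delta>: "\<delta> \<in> \<Gamma>" for \<gamma> \<delta>
  proof (cases "\<gamma> + \<delta> < m")
    case True
    then show ?thesis
      using spec_pow_in_span_alg[OF sol \<Gamma>_add[OF \<gamma> \<delta> True] Rel_add[OF a_Rel[OF \<gamma>] a_Rel[OF \<delta>]]]
      by (simp add: spec_pow_add)
  next
    case False
    have "lead (\<gamma> + \<delta>) (?B \<gamma> * ?B \<delta>)"
      by (intro lead_mult lead_a \<gamma> \<delta>)
    then have "coeff (?B \<gamma> * ?B \<delta>) i = coeff [:0:] i" if "i < m" for i
      using that False by (simp add: lead_def)
    then show ?thesis
      using span_alg_congruent[OF span_alg_const] by blast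
  qed
  \<comment> \<open>Used twice: first to pass from spanning elements to all of the module in one
    factor, then in the other.\<close>
  have expand: "f * h \<in> span_alg l"
    if f: "f \<in> span_alg l" and h: "h \<in> span_alg l" and B: "\<And>\<gamma>. \<gamma> \<in> \<Gamma> \<Longrightarrow> ?B \<gamma> * h \<in> span_alg l" for f h
  proof -
    obtain c r g where eq: "f = [:c:] + (\<Sum>\<gamma>\<in>\<Gamma>. smult (r \<gamma>) (?B \<gamma>)) + monom 1 m * g"
      using f by (rule span_algE)
    have "f * h = smult c h + (\<Sum>\<gamma>\<in>\<Gamma>. smult (r \<gamma>) (?B \<gamma> * h)) + monom 1 m * (g * h)"
      by (simp add: eq distrib_right sum_distrib_right mult.assoc)
    then show ?thesis
      using B h by (simp add: span_alg_add span_alg_sum span_alg_smult span_alg_monom_mult)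
  qed
  have "?B \<gamma> * h \<in> span_alg l" if \<gamma>: "\<gamma> \<in> \<Gamma>" for \<gamma>
    unfolding mult.commute[of _ h]
    by (rule expand[OF assms(3) span_alg_basis[OF \<gamma>] basis[OF _ \<gamma>]])
  then show ?thesis
    by (rule expand[OF assms(2,3)])
qed

lemma span_alg_points:
  assumes sol: "\<forall>p\<in>relations m \<Gamma> a. eval_hom \<phi> l p = 0"
  shows "span_alg l \<in> points m \<Gamma>"
proof -
  interpret R: cring "ring_of_type_algebra :: 'r poly ring"
    by (rule cring_type_algebra)
  have "subring (span_alg l) ring_of_type_algebra"
  proof (rule R.subringI)
    show "\<one>\<^bsub>ring_of_type_algebra\<^esub> \<in> span_alg l"
      using span_alg_const[of 1 l] by (simp add: one_pCons)
    show "\<ominus>\<^bsub>ring_of_type_algebra\<^esub> f \<in> span_alg l" if "f \<in> span_alg l" for f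
      using span_alg_smult[OF that, of "- 1"] by (simp add: type_algebra_a_inv)
  qed (use span_alg_mult[OF sol] span_alg_add in auto)
  then show ?thesis
    by (simp add: points_def subalg_def span_alg_const span_alg_monom_mult low_coeffs_span_alg)
qed

end

section \<open>Points are spanned by products of their canonical elements\<close>

context relations_setup
begin

text \<open>When all lower coefficients vanish, the coefficient in a gap \<open>j\<close> belongs to
  \<open>low_coeffs A j\<close>, which is zero for a point.\<close>

lemma point_coeffs_eq_0:
  fixes A :: "'r::comm_ring_1 poly set"
  assumes A: "A \<in> points m \<Gamma>" and f: "f \<in> A" and zero: "\<And>j. j = 0 \<or> j \<in> \<Gamma> \<Longrightarrow> coeff f j = 0"
    and "j < m"
  shows "coeff f j = 0"
  using \<open>j < m\<close>
proof (induction j rule: less_induct)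
  case (less j)
  show ?case
  proof (cases "j = 0 \<or> j \<in> \<Gamma>")
    case False
    then have "low_coeffs A j = {0}"
      using A less.prems by (auto simp: points_def)
    moreover have "coeff f j \<in> low_coeffs A j"
      unfolding low_coeffs_def using less f by (intro CollectI exI[of _ f]) simp
    ultimately show ?thesis
      by simp
  qed (rule zero)
qed

lemma spec_pow_in_point:
  fixes A :: "'r::comm_ring_1 poly set"
  assumes A: "subalg A" and gen: "\<And>\<nu>. \<nu> \<in> ind \<Gamma> \<Longrightarrow> spec_gen m \<Gamma> l \<nu> \<in> A"
  shows "spec_pow m \<Gamma> l b \<in> A"
proof -
  have one: "1 \<in> A"
    using subalgD(1)[OF A, of 1] by (simp add: one_pCons)
  have pow: "f ^ n \<in> A" if "f \<in> A" for f n
    using that by (induction n) (auto simp: one subalgD(3)[OF A])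
  have "(\<Prod>\<nu>\<in>K. spec_gen m \<Gamma> l \<nu> ^ b \<nu>) \<in> A" if "K \<subseteq> ind \<Gamma>" for K
    using that by (induction K rule: infinite_finite_induct) (auto simp: one pow gen subalgD(3)[OF A])
  then show ?thesis
    by (simp add: spec_pow_def)
qed

lemma spec_gen_coords:
  fixes A :: "'r::comm_ring_1 poly set"
  assumes A: "A \<in> points m \<Gamma>" and \<nu>: "\<nu> \<in> ind \<Gamma>"
  shows "spec_gen m \<Gamma> (coords m \<Gamma> A) \<nu> \<in> A"
proof -
  have can: "canonical m \<Gamma> A \<nu> (basis_elem m \<Gamma> A \<nu>)"
    unfolding basis_elem_def by (rule theI'[OF canonical_unique[OF A m semi]]) (use \<nu> ind_subset in blast)
  then obtain l' where l': "basis_elem m \<Gamma> A \<nu> = spec_gen m \<Gamma> (\<lambda>(_, j). l' j) \<nu>"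
    by (auto simp: canonical_def spec_gen_def)
  have "basis_elem m \<Gamma> A \<nu> = spec_gen m \<Gamma> (coords m \<Gamma> A) \<nu>"
  proof (rule poly_eqI)
    fix j
    have "coords m \<Gamma> A (\<nu>, j) = l' j" if "j \<in> gaps m \<Gamma> \<nu>"
      using that \<nu> by (auto simp: coords_def vars_def l' coeff_spec_gen gaps_def)
    then show "coeff (basis_elem m \<Gamma> A \<nu>) j = coeff (spec_gen m \<Gamma> (coords m \<Gamma> A) \<nu>) j"
      by (simp add: l' coeff_spec_gen)
  qed
  then show ?thesis
    using can by (simp add: canonical_def)
qed

lemma coords_eqI:
  fixes A :: "'r::comm_ring_1 poly set"
  assumes A: "A \<in> points m \<Gamma>" and l: "l \<in> vars m \<Gamma> \<rightarrow>\<^sub>E UNIV"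
    and gen: "\<And>\<nu>. \<nu> \<in> ind \<Gamma> \<Longrightarrow> spec_gen m \<Gamma> l \<nu> \<in> A"
  shows "coords m \<Gamma> A = l"
proof (rule extensionalityI[of _ "vars m \<Gamma>"])
  show "coords m \<Gamma> A \<in> extensional (vars m \<Gamma>)" "l \<in> extensional (vars m \<Gamma>)"
    using l by (auto simp: coords_def PiE_def)
  fix v assume "v \<in> vars m \<Gamma>"
  then obtain \<nu> j where v: "v = (\<nu>, j)" "\<nu> \<in> ind \<Gamma>" "j \<in> gaps m \<Gamma> \<nu>"
    by (auto simp: vars_def)
  have "canonical m \<Gamma> A \<nu> (spec_gen m \<Gamma> l \<nu>)"
    using gen[OF v(2)] by (auto simp: canonical_def spec_gen_def)
  then have "basis_elem m \<Gamma> A \<nu> = spec_gen m \<Gamma> l \<nu>"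
    unfolding basis_elem_def
    by (intro the1_equality canonical_unique[OF A m semi]) (use v(2) ind_subset in blast)
  then show "coords m \<Gamma> A v = l v"
    using v by (auto simp: coords_def vars_def coeff_spec_gen gaps_def)
qed

text \<open>For the harder inclusion, an element of \<open>A\<close> is modified by the module until
  its coefficients in degree 0 and in degrees from \<Gamma> vanish; by
  \<open>point_coeffs_eq_0\<close> the remainder lies in \<open>x^m R[x]\<close>.\<close>

lemma point_eq_span_alg:
  fixes A :: "'r::comm_ring_1 poly set"
  assumes A: "A \<in> points m \<Gamma>"
  shows "A = span_alg (coords m \<Gamma> A)"
proof -
  define l where "l = coords m \<Gamma> A"
  have sub: "subalg A" and xm: "\<And>g. monom 1 m * g \<in> A"
    using A by (auto simp: points_def)
  have pow: "spec_pow m \<Gamma> l b \<in> A" for b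
    unfolding l_def by (intro spec_pow_in_point sub spec_gen_coords A)
  have sum: "(\<Sum>\<gamma>\<in>K. smult (r \<gamma>) (spec_pow m \<Gamma> l (a \<gamma>))) \<in> A" for K r
    using subalgD(1)[OF sub, of 0]
    by (induction K rule: infinite_finite_induct) (simp_all add: subalgD(2,4)[OF sub] pow)
  have "span_alg l \<subseteq> A"
  proof
    fix f assume "f \<in> span_alg l"
    then obtain c r g where "f = [:c:] + (\<Sum>\<gamma>\<in>\<Gamma>. smult (r \<gamma>) (spec_pow m \<Gamma> l (a \<gamma>))) + monom 1 m * g"
      by (rule span_algE)
    then show "f \<in> A"
      by (simp only: subalgD(1,2)[OF sub] sum xm)
  qed
  moreover have "f \<in> span_alg l" if f: "f \<in> A" for f
  proof -
    \<comment> \<open>Degrees are cleared from below: a correction starting in degree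
      \<open>k\<close> leaves the coefficients already cleared untouched.\<close>
    have "\<exists>h\<in>span_alg l. \<forall>i<k. i = 0 \<or> i \<in> \<Gamma> \<longrightarrow> coeff (f - h) i = 0" for k
    proof (induction k)
      case 0
      show ?case
        using span_alg_const by blast
    next
      case (Suc k)
      then obtain h where h: "h \<in> span_alg l" "\<forall>i<k. i = 0 \<or> i \<in> \<Gamma> \<longrightarrow> coeff (f - h) i = 0"
        by blast
      show ?case
      proof (cases "k = 0 \<or> k \<in> \<Gamma>")
        case True
        obtain e where e: "e \<in> span_alg l" "lead k e"
        proof (cases "k = 0")
          case True
          then show ?thesis
            using that[of 1] span_alg_const[of 1 l] lead_1 by (simp add: one_pCons)
        next
          case False
          then show ?thesis
            using that[of "spec_pow m \<Gamma> l (a k)"] \<open>k = 0 \<or> k \<in> \<Gamma>\<close> span_alg_basis lead_a by blast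
        qed
        show ?thesis
        proof (rule bexI[of _ "h + smult (coeff (f - h) k) e"])
          show "\<forall>i<Suc k. i = 0 \<or> i \<in> \<Gamma> \<longrightarrow> coeff (f - (h + smult (coeff (f - h) k) e)) i = 0"
          proof (intro allI impI)
            fix i assume i: "i < Suc k" "i = 0 \<or> i \<in> \<Gamma>"
            show "coeff (f - (h + smult (coeff (f - h) k) e)) i = 0"
            proof (cases "i = k")
              case True
              have "coeff e k = 1"
                using e(2) by (simp add: lead_def)
              then show ?thesis
                using True by simp
            next
              case False
              then have "i < k"
                using i(1) by simp
              then have "coeff e i = 0" "coeff (f - h) i = 0"
                using i(2) h(2) e(2) unfolding lead_def by blast+
              then show ?thesis
                by simp
            qed
          qed
        qed (intro span_alg_add span_alg_smult h e)
      next
        case False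
        then have "\<forall>i<Suc k. i = 0 \<or> i \<in> \<Gamma> \<longrightarrow> coeff (f - h) i = 0"
          using h(2) unfolding less_Suc_eq by blast
        then show ?thesis
          using h(1) by blast
      qed
    qed
    from this[of m] obtain h where h: "h \<in> span_alg l" "\<forall>i<m. i = 0 \<or> i \<in> \<Gamma> \<longrightarrow> coeff (f - h) i = 0"
      by blast
    have "f - h \<in> A"
      using f h(1) \<open>span_alg l \<subseteq> A\<close> by (intro subalgD(5)[OF sub]) auto
    moreover have "coeff (f - h) j = 0" if "j = 0 \<or> j \<in> \<Gamma>" for j
    proof -
      have "j < m"
        using that \<Gamma>_bounds(2) m by fastforce
      then show ?thesis
        using h(2) that by blast
    qed
    ultimately have "coeff (f - h) i = 0" if "i < m" for i
      using that by (rule point_coeffs_eq_0[OF A])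
    then have "coeff f i = coeff h i" if "i < m" for i
      using that by simp
    then show ?thesis
      by (rule span_alg_congruent[OF h(1)])
  qed
  ultimately show ?thesis
    unfolding l_def by blast
qed

end

context relations_setup_hom
begin

text \<open>The difference \<open>f\<close> of the two sides, as polynomials in \<open>x\<close>,
  lies in \<open>A\<close> and vanishes in degree 0 and in degrees from \<Gamma> by
  \<open>relation_eq_0\<close>; hence it vanishes in the gaps as well.\<close>

lemma eval_relations_coords:
  assumes A: "A \<in> points m \<Gamma>" and p: "p \<in> relations m \<Gamma> a"
  shows "eval_hom \<phi> (coords m \<Gamma> A) p = 0"
proof -
  obtain \<gamma> b j where idx: "p = relation m \<Gamma> a \<gamma> b j" "(\<gamma>, b, j) \<in> rel_index m \<Gamma> a"
    using p by (auto simp: relations_def)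
  then have \<gamma>: "\<gamma> \<in> \<Gamma>" and b: "b \<in> Rel \<Gamma> \<gamma>" and j: "j < m"
    using m by (auto simp: rel_index_def dec2_def dec_def gaps_def)
  define l where "l = coords m \<Gamma> A"
  define f where "f = spec_pow m \<Gamma> l b - (spec_pow m \<Gamma> l (a \<gamma>) + (\<Sum>\<gamma>'\<in>above \<Gamma> \<gamma>.
    smult (eval_hom \<phi> l (theta m \<Gamma> a \<gamma> b \<gamma>')) (spec_pow m \<Gamma> l (a \<gamma>'))))"
  have sub: "subalg A"
    using A by (auto simp: points_def)
  have pow: "spec_pow m \<Gamma> l b \<in> A" for b
    unfolding l_def by (intro spec_pow_in_point sub spec_gen_coords A)
  have "(\<Sum>\<gamma>'\<in>K. smult (r \<gamma>') (spec_pow m \<Gamma> l (a \<gamma>'))) \<in> A" for K r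
    using subalgD(1)[OF sub, of 0]
    by (induction K rule: infinite_finite_induct) (simp_all add: subalgD(2,4)[OF sub] pow)
  then have "f \<in> A"
    unfolding f_def by (intro subalgD(2,5)[OF sub] pow)
  have coeff_f: "coeff f i = eval_hom \<phi> l (relation m \<Gamma> a \<gamma> b i)" for i
    by (simp add: f_def eval_relation)
  have "coeff f j = 0"
    by (rule point_coeffs_eq_0[OF A \<open>f \<in> A\<close> _ j])
      (auto simp: coeff_f relation_eq_0[OF \<gamma> b] eval_hom_0)
  then show ?thesis
    by (simp add: coeff_f idx(1) l_def)
qed

theorem bij_betw_coords:
  "bij_betw (coords m \<Gamma>) (points m \<Gamma> :: 'r poly set set)
    {l \<in> vars m \<Gamma> \<rightarrow>\<^sub>E UNIV. \<forall>p\<in>relations m \<Gamma> a. eval_hom \<phi> l p = 0}"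
proof (rule bij_betw_byWitness[where f' = span_alg])
  show "\<forall>A\<in>points m \<Gamma>. span_alg (coords m \<Gamma> A) = A"
    using point_eq_span_alg by blast
  show "coords m \<Gamma> ` points m \<Gamma> \<subseteq> {l \<in> vars m \<Gamma> \<rightarrow>\<^sub>E UNIV. \<forall>p\<in>relations m \<Gamma> a. eval_hom \<phi> l p = 0}"
    using eval_relations_coords by (auto simp: coords_def)
  show "span_alg ` {l \<in> vars m \<Gamma> \<rightarrow>\<^sub>E UNIV. \<forall>p\<in>relations m \<Gamma> a. eval_hom \<phi> l p = 0} \<subseteq> points m \<Gamma>"
    using span_alg_points by blast
  show "\<forall>l\<in>{l \<in> vars m \<Gamma> \<rightarrow>\<^sub>E UNIV. \<forall>p\<in>relations m \<Gamma> a. eval_hom \<phi> l p = 0}. coords m \<Gamma> (span_alg l) = l"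
  proof
    fix l :: "nat \<times> nat \<Rightarrow> 'r"
    assume l: "l \<in> {l \<in> vars m \<Gamma> \<rightarrow>\<^sub>E UNIV. \<forall>p\<in>relations m \<Gamma> a. eval_hom \<phi> l p = 0}"
    show "coords m \<Gamma> (span_alg l) = l"
    proof (rule coords_eqI)
      fix \<nu> assume \<nu>: "\<nu> \<in> ind \<Gamma>"
      then have "\<nu> \<in> \<Gamma>"
        using ind_subset by blast
      \<comment> \<open>The convention that \<open>a \<nu>\<close> is a unit vector makes the
        generator itself one of the spanning elements.\<close>
      from span_alg_basis[OF this, of l] show "spec_gen m \<Gamma> l \<nu> \<in> span_alg l"
        by (simp only: a_ind[OF \<nu>] spec_pow_unit_vec[OF \<nu>])
    qed (use l span_alg_points in auto)
  qed
qed

end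

section \<open>The number of relations and the dimension\<close>

lemma coeff_mult_polys:
  assumes "\<And>j. coeff p j \<in> polys V" "\<And>j. coeff q j \<in> polys V"
  shows "coeff (p * q) j \<in> polys V"
  unfolding coeff_mult by (intro polys_sum polys_mult assms)

lemma coeff_gen_pow_polys:
  "coeff (gen_pow m \<Gamma> b) j \<in> (polys (vars m \<Gamma>) :: 'k::comm_ring_1 mpol set)" (is "_ \<in> ?P")
proof -
  have one: "coeff 1 j \<in> ?P" for j
    by (simp add: polys_0 polys_1)
  have gen: "coeff (spec_gen m \<Gamma> Var \<nu>) j \<in> ?P" if "\<nu> \<in> ind \<Gamma>" for \<nu> j
    using that by (auto simp: coeff_spec_gen polys_0 polys_1 vars_def intro: polys_Var)
  have pow: "coeff (spec_gen m \<Gamma> Var \<nu> ^ n) j \<in> ?P" if "\<nu> \<in> ind \<Gamma>" for \<nu> n j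
  proof (induction n arbitrary: j)
    case (Suc n)
    show ?case
      unfolding power_Suc by (rule coeff_mult_polys[OF gen[OF that] Suc])
  qed (simp only: power_0 one)
  have "coeff (\<Prod>\<nu>\<in>K. spec_gen m \<Gamma> Var \<nu> ^ b \<nu>) j \<in> ?P" if "K \<subseteq> ind \<Gamma>" for K j
    using that
  proof (induction K arbitrary: j rule: infinite_finite_induct)
    case (insert \<nu> K)
    then show ?case
      unfolding prod.insert[OF insert.hyps] by (intro coeff_mult_polys pow) auto
  next
    case (infinite K)
    show ?case
      unfolding prod.infinite[OF infinite(1)] by (rule one)
  qed (simp only: prod.empty one)
  then show ?thesis
    by (simp only: gen_pow_eq_spec_pow spec_pow_def order_refl)
qed

lemma theta_polys: "theta m \<Gamma> a \<gamma> b \<gamma>' \<in> (polys (vars m \<Gamma>) :: 'k::comm_ring_1 mpol set)"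
proof (induction \<gamma>' rule: less_induct)
  case (less \<gamma>')
  have "(\<Sum>\<gamma>''\<in>between \<Gamma> \<gamma> \<gamma>'. theta m \<Gamma> a \<gamma> b \<gamma>'' * coeff (gen_pow m \<Gamma> (a \<gamma>'')) \<gamma>') \<in>
      (polys (vars m \<Gamma>) :: 'k mpol set)"
    by (intro polys_sum polys_mult coeff_gen_pow_polys less) (auto simp: between_def)
  then show ?case
    unfolding theta.simps[of m \<Gamma> a \<gamma> b \<gamma>'] coeff_diff by (intro polys_diff coeff_gen_pow_polys)
qed

lemma relation_polys: "relation m \<Gamma> a \<gamma> b j \<in> polys (vars m \<Gamma>)"
  unfolding relation_def
  by (intro polys_diff polys_add polys_sum polys_mult theta_polys coeff_gen_pow_polys)

lemma relations_polys: "relations m \<Gamma> a \<subseteq> polys (vars m \<Gamma>)"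
  by (auto simp: relations_def relation_polys)

lemma finite_vars: "finite (ind \<Gamma>) \<Longrightarrow> finite (vars m \<Gamma>)"
  by (simp add: vars_def finite_gaps)

lemma card_vars: "finite (ind \<Gamma>) \<Longrightarrow> card (vars m \<Gamma>) = n_vars m \<Gamma>"
  unfolding vars_def n_vars_def by (rule card_SigmaI) (auto simp: finite_gaps)

text \<open>At the origin every generator degenerates to the monomial
  \<open>x^\<nu>\<close>.\<close>

lemma spec_pow_zero:
  assumes "b \<in> Rel \<Gamma> \<gamma>"
  shows "spec_pow m \<Gamma> (\<lambda>_. 0 :: 'r::comm_ring_1) b = monom 1 \<gamma>"
proof -
  have "spec_gen m \<Gamma> (\<lambda>_. 0 :: 'r) \<nu> = monom 1 \<nu>" for \<nu>
    by (simp add: spec_gen_def)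
  moreover have "(\<Prod>\<nu>\<in>K. monom 1 \<nu> ^ b \<nu>) = (monom 1 (\<Sum>\<nu>\<in>K. b \<nu> * \<nu>) :: 'r poly)" for K
    by (induction K rule: infinite_finite_induct) (simp_all add: monom_power mult_monom mult.commute)
  ultimately show ?thesis
    using assms by (simp add: spec_pow_def Rel_def)
qed

context relations_setup
begin

lemma rel_index_eq: "rel_index m \<Gamma> a = (SIGMA \<gamma>:dec2 \<Gamma>. (Rel \<Gamma> \<gamma> - {a \<gamma>}) \<times> gaps m \<Gamma> \<gamma>)"
  by (auto simp: rel_index_def)

lemma finite_dec2: "finite (dec2 \<Gamma>)"
  by (rule finite_subset[OF _ finite_\<Gamma>]) (auto simp: dec2_def dec_def)

lemma finite_rel_index: "finite (rel_index m \<Gamma> a)"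
  unfolding rel_index_eq by (intro finite_SigmaI finite_dec2 finite_cartesian_product finite_Diff finite_Rel finite_gaps)

lemma card_rel_index: "card (rel_index m \<Gamma> a) = n_eqs m \<Gamma>"
proof -
  have "card (rel_index m \<Gamma> a) = (\<Sum>\<gamma>\<in>dec2 \<Gamma>. card ((Rel \<Gamma> \<gamma> - {a \<gamma>}) \<times> gaps m \<Gamma> \<gamma>))"
    unfolding rel_index_eq by (rule card_SigmaI) (auto intro: finite_dec2 finite_Rel finite_gaps)
  also have "\<dots> = n_eqs m \<Gamma>"
    unfolding n_eqs_def
    by (rule sum.cong) (auto simp: card_cartesian_product card_Diff_singleton dec2_def a_dec)
  finally show ?thesis .
qed

text \<open>At the origin all products in a relation are monomials with degrees in \<Gamma>, so they
  contribute nothing in a gap \<open>j\<close>, whatever the values of \<open>theta\<close>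
  are.\<close>

lemma lookup_relations_0:
  fixes p :: "'k::comm_ring_1 mpol"
  assumes "p \<in> relations m \<Gamma> a"
  shows "lookup p 0 = 0"
proof -
  interpret coeff_hom "\<lambda>c :: 'k. c"
    by unfold_locales (rule ring_hom_memI, simp_all)
  obtain \<gamma> b j where p: "p = relation m \<Gamma> a \<gamma> b j" and idx: "(\<gamma>, b, j) \<in> rel_index m \<Gamma> a"
    using assms by (auto simp: relations_def)
  have \<gamma>: "\<gamma> \<in> \<Gamma>" "b \<in> Rel \<Gamma> \<gamma>" and j: "j \<notin> \<Gamma>"
    using idx by (auto simp: rel_index_def dec2_def dec_def gaps_def)
  have zero: "coeff (spec_pow m \<Gamma> (\<lambda>_. 0 :: 'k) b') j = 0" if "b' \<in> Rel \<Gamma> \<delta>" "\<delta> \<in> \<Gamma>" for b' \<delta>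
    using that j by (auto simp: spec_pow_zero)
  have "coeff (\<Sum>\<gamma>'\<in>above \<Gamma> \<gamma>. smult (t \<gamma>') (spec_pow m \<Gamma> (\<lambda>_. 0 :: 'k) (a \<gamma>'))) j = 0" for t
    unfolding coeff_sum by (rule sum.neutral) (auto simp: above_def zero[OF a_Rel])
  then show ?thesis
    using zero[OF \<gamma>(2,1)] zero[OF a_Rel[OF \<gamma>(1)] \<gamma>(1)]
    by (simp only: p eval_hom_zero[symmetric] eval_relation coeff_add) simp
qed

lemma krull_dim_factor_alg:
  "ereal (real (n_vars m \<Gamma>) - real (n_eqs m \<Gamma>)) \<le> krull_dim (factor_alg m \<Gamma> a :: 'k::field mpol set ring)"
proof -
  let ?F = "relations m \<Gamma> a :: 'k mpol set"
  have fin: "finite ?F"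
    unfolding relations_def by (intro finite_imageI finite_rel_index)
  \<comment> \<open>\<open>n_eqs\<close> counts indices, and different indices may yield the same
    polynomial, so only an inequality holds; it has the direction the bound requires.\<close>
  have "card ?F \<le> n_eqs m \<Gamma>"
    unfolding relations_def card_rel_index[symmetric] by (rule card_image_le[OF finite_rel_index])
  then have "ereal (real (n_vars m \<Gamma>) - real (n_eqs m \<Gamma>)) \<le> ereal (real (card (vars m \<Gamma>)) - real (card ?F))"
    by (simp add: card_vars finite_ind)
  also have "\<dots> \<le> krull_dim (factor_alg m \<Gamma> a :: 'k mpol set ring)"
    unfolding factor_alg_def rel_ideal_def P_ring_eq
    by (rule krull_dim_poly_ring_Quot[OF finite_vars[OF finite_ind] fin relations_polys lookup_relations_0])
  finally show ?thesis .
qed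

end

lemma bij_betw_ex1:
  assumes "bij_betw f A C" "c \<in> C"
  shows "\<exists>!x. x \<in> A \<and> f x = c"
  using assms by (auto simp: bij_betw_def inj_on_def)

text \<open>The algebra of regular functions is captured by its functor of points: for any ring with
  a coefficient map \<phi>, points and algebra homomorphisms from the factor algebra correspond by
  equal coordinates. This covers finite fields and ideals that are not radical.\<close>

theorem theorem4p3:
  fixes m :: nat
    and \<Gamma> :: "nat set"
    and a :: "nat \<Rightarrow> nat \<Rightarrow> nat"
    and \<phi> :: "'k::field \<Rightarrow> 'r::comm_ring_1"
  assumes "4 \<le> m"
    and "\<Gamma> \<in> semi_sets m"
    and "2 \<le> card (ind \<Gamma>)"
    and "dec2 \<Gamma> \<noteq> {}"
    and "\<forall>\<gamma>\<in>dec \<Gamma>. a \<gamma> \<in> Rel \<Gamma> \<gamma>"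
    and "\<forall>\<nu>\<in>ind \<Gamma>. a \<nu> = unit_vec \<nu>"
    and "\<phi> \<in> ring_hom ring_of_type_algebra ring_of_type_algebra"
  shows
    "finite (vars m \<Gamma>) \<and> card (vars m \<Gamma>) = n_vars m \<Gamma> \<and>
     bij_betw (coords m \<Gamma>) (algs_of m \<Gamma> :: 'k poly set set)
       {l \<in> vars m \<Gamma> \<rightarrow>\<^sub>E UNIV. \<forall>p\<in>relations m \<Gamma> a. evalm l p = 0} \<and>
     (\<forall>A\<in>points m \<Gamma> :: 'r poly set set.
        \<exists>!h. h \<in> alg_homs \<phi> m \<Gamma> a \<and> hom_coords m \<Gamma> a h = coords m \<Gamma> A) \<and>
     (\<forall>h\<in>alg_homs \<phi> m \<Gamma> a.
        \<exists>!A. A \<in> (points m \<Gamma> :: 'r poly set set) \<and> coords m \<Gamma> A = hom_coords m \<Gamma> a h) \<and>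
     finite (rel_index m \<Gamma> a) \<and> card (rel_index m \<Gamma> a) = n_eqs m \<Gamma> \<and>
     ereal (real (n_vars m \<Gamma>) - real (n_eqs m \<Gamma>)) \<le>
       krull_dim (factor_alg m \<Gamma> a :: 'k mpol set ring)"
proof -
  interpret relations_setup m \<Gamma> a
    by unfold_locales (use assms in auto)
  \<comment> \<open>The points over the field itself are the instance in which the coefficient map
    is the identity.\<close>
  have id: "(\<lambda>c :: 'k. c) \<in> ring_hom ring_of_type_algebra ring_of_type_algebra"
    by (rule ring_hom_memI) simp_all
  have coords_K: "bij_betw (coords m \<Gamma>) (algs_of m \<Gamma> :: 'k poly set set)
      {l \<in> vars m \<Gamma> \<rightarrow>\<^sub>E UNIV. \<forall>p\<in>relations m \<Gamma> a. evalm l p = 0}"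
    unfolding points_field[OF assms(1,2), symmetric] evalm_eq_eval_hom
    by (rule relations_setup_hom.bij_betw_coords)
      (intro relations_setup_hom.intro relations_setup_axioms coeff_hom.intro id)
  \<comment> \<open>Points and homomorphisms are both in bijection with this set through their
    coordinates, which yields the two unique-existence claims.\<close>
  let ?sol = "{l \<in> vars m \<Gamma> \<rightarrow>\<^sub>E UNIV. \<forall>p\<in>relations m \<Gamma> a. eval_hom \<phi> l p = 0}"
  have pts: "bij_betw (coords m \<Gamma>) (points m \<Gamma> :: 'r poly set set) ?sol"
    by (rule relations_setup_hom.bij_betw_coords)
      (intro relations_setup_hom.intro relations_setup_axioms coeff_hom.intro assms(7))
  have homs: "bij_betw (hom_coords m \<Gamma> a) (alg_homs \<phi> m \<Gamma> a) ?sol"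
    by (rule bij_betw_hom_coords[OF assms(7) relations_polys])
  show ?thesis
    using coords_K bij_betw_ex1[OF homs bij_betwE[OF pts, rule_format]]
      bij_betw_ex1[OF pts bij_betwE[OF homs, rule_format]] krull_dim_factor_alg
    by (intro conjI ballI finite_vars card_vars finite_ind finite_rel_index card_rel_index)
qed

end
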